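(* Let $\alpha,\beta,B$ be real numbers with $$\alpha\in(0,1),\qquad \beta>\frac{1}{1-\alpha},\qquad B>\frac{1}{1-\alpha},$$ and let $\mu_1,\mu_2,H$ be real numbers with $0<\mu_1<\mu_2$ and $H>0$. Let $A$ be an operator as in the context, and let $\mathbb{X}:=\mathcal{F}\times\mathcal{G}_{\beta,\infty}(A)$ be the complete metric space defined in the context. Then the set of all pairs $(c,\psi)\in\mathbb{X}$ such that the very weak solution $u$ to $$u''(t)+c(t)Au(t)=0\quad (t\ge 0),\qquad u(0)=0,\quad u'(0)=\psi,$$ satisfies $$(u(t),u'(t))\notin\mathcal{G}_{-B,R}(A)\times\mathcal{G}_{-B,R}(A)\qquad\text{for every } t>0 \text{ and every } R>0$$ is residual in $\mathbb{X}$.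
   Context: $\mathcal{H}$ is an infinite dimensional (real) Hilbert space, and $A$ is a nonnegative self-adjoint linear operator on $\mathcal{H}$ with dense domain, such that there exist an orthonormal basis $\{e_i\}_{i\in\mathbb{N}}$ of $\mathcal{H}$ and a nondecreasing sequence $\{\lambda_i\}$ of nonnegative real numbers with $\lambda_i\to+\infty$ and $Ae_i=\lambda_i^2e_i$ for every $i\in\mathbb{N}$. Elements of $\mathcal{H}$ are identified with the sequences of their components with respect to $\{e_i\}$; more generally one considers arbitrary sequences of real numbers. Very weak solution: given a continuous function $c:[0,+\infty)\to\mathbb{R}$ and sequences $u_0=\{u_{0,i}\}$, $u_1=\{u_{1,i}\}$ of real numbers, the very weak solution to $u''+c(t)Au=0$, $u(0)=u_0$, $u'(0)=u_1$ is the (unique) sequence $u(t)=\{u_i(t)\}$ of $C^2$ functions on $[0,+\infty)$ such that $u_i''(t)+c(t)\lambda_i^2u_i(t)=0$ for every $t\ge 0$, $u_i(0)=u_{0,i}$, $u_i'(0)=u_{1,i}$, for every $i\in\mathbb{N}$; and $u'(t):=\{u_i'(t)\}$. Gevrey ultradistributions: for $S>0$, $R>0$, $\mathcal{G}_{-S,R}(A)$ is the set of sequences $u=\{u_i\}$ of real numbers such that $\sum_{i=0}^{\infty}u_i^2\exp\left(-2R\lambda_i^{1/S}\right)<+\infty$. For $s>0$, $\mathcal{G}_{s,\infty}(A)$ is the set of sequences $\psi=\{\psi_i\}$ of real numbers such that $$\|\psi\|_{\mathcal{G}_{s,\infty}(A)}^2:=\sum_{i=0}^{\infty}\psi_i^2\exp\left(\lambda_i^{1/s}\log(1+\lambda_i)\right)<+\infty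 .$$ $\mathcal{F}$ is the set of functions $c:[0,+\infty)\to[\mu_1,\mu_2]$ such that $|c(t)-c(s)|\le H|t-s|^{\alpha}$ for all $(t,s)\in[0,+\infty)^2$, with distance $\operatorname{dist}_{\mathcal{F}}(c_1,c_2):=\sup_{t\ge 0}|c_1(t)-c_2(t)|$. The space $\mathbb{X}=\mathcal{F}\times\mathcal{G}_{\beta,\infty}(A)$ is a complete metric space with the distance $\operatorname{dist}_{\mathbb{X}}((c_1,\psi_1),(c_2,\psi_2)):=\operatorname{dist}_{\mathcal{F}}(c_1,c_2)+\|\psi_1-\psi_2\|_{\mathcal{G}_{\beta,\infty}(A)}$. A subset of a complete metric space is residual if its complement is contained in a countable union of closed sets with empty interior. *)

theory Defs
  imports "HOL-Analysis.Analysis"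
begin

section \<open>The operator\<close>

text \<open>Unbounded operators are partial functions, given by a domain \<open>D\<close> and a total function \<open>A\<close>
  whose values off \<open>D\<close> are irrelevant. Self-adjointness is equality of graphs \<open>A\<^sup>* = A\<close>, which
  includes equality of the domains.\<close>

definition densely_defined_operator :: "'a::real_inner set \<Rightarrow> ('a \<Rightarrow> 'a) \<Rightarrow> bool" where
  "densely_defined_operator D A \<longleftrightarrow>
     subspace D \<and> closure D = UNIV \<and>
     (\<forall>x\<in>D. \<forall>y\<in>D. A (x + y) = A x + A y) \<and> (\<forall>r. \<forall>x\<in>D. A (r *\<^sub>R x) = r *\<^sub>R A x)"

definition adjoint_graph :: "'a::real_inner set \<Rightarrow> ('a \<Rightarrow> 'a) \<Rightarrow> ('a \<times> 'a) set" where
  "adjoint_graph D A = {(y, z). \<forall>x\<in>D. A x \<bullet> y = x \<bullet> z}"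

definition self_adjoint_operator :: "'a::real_inner set \<Rightarrow> ('a \<Rightarrow> 'a) \<Rightarrow> bool" where
  "self_adjoint_operator D A \<longleftrightarrow>
     densely_defined_operator D A \<and> adjoint_graph D A = {(x, A x) | x. x \<in> D}"

definition nonnegative_operator :: "'a::real_inner set \<Rightarrow> ('a \<Rightarrow> 'a) \<Rightarrow> bool" where
  "nonnegative_operator D A \<longleftrightarrow> (\<forall>x\<in>D. 0 \<le> A x \<bullet> x)"

definition orthonormal_basis :: "(nat \<Rightarrow> 'a::real_inner) \<Rightarrow> bool" where
  "orthonormal_basis e \<longleftrightarrow>
     (\<forall>i j. e i \<bullet> e j = (if i = j then 1 else 0)) \<and> closure (span (range e)) = UNIV"

text \<open>The eigenvalues of \<open>A\<close> are the \<^emph>\<open>squares\<close> of the \<open>lam i\<close>.\<close>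

definition diagonalized_by ::
    "'a::real_inner set \<Rightarrow> ('a \<Rightarrow> 'a) \<Rightarrow> (nat \<Rightarrow> 'a) \<Rightarrow> (nat \<Rightarrow> real) \<Rightarrow> bool" where
  "diagonalized_by D A e lam \<longleftrightarrow>
     orthonormal_basis e \<and> (\<forall>i. 0 \<le> lam i) \<and> mono lam \<and> filterlim lam at_top sequentially \<and>
     (\<forall>i. e i \<in> D \<and> A (e i) = (lam i)\<^sup>2 *\<^sub>R e i)"


section \<open>Spaces of sequences and very weak solutions\<close>

text \<open>All the notions below see \<open>A\<close> only through the sequence \<open>lam\<close>.\<close>

definition gevrey_ultradistributions ::
    "(nat \<Rightarrow> real) \<Rightarrow> real \<Rightarrow> real \<Rightarrow> (nat \<Rightarrow> real) set"  (* \<G>_{-S,R}(A) *) where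
  "gevrey_ultradistributions lam S R =
     {u. summable (\<lambda>i. (u i)\<^sup>2 * exp (- 2 * R * lam i powr (1 / S)))}"

definition gevrey_inf :: "(nat \<Rightarrow> real) \<Rightarrow> real \<Rightarrow> (nat \<Rightarrow> real) set"  (* \<G>_{s,\<infinity>}(A) *) where
  "gevrey_inf lam s =
     {\<psi>. summable (\<lambda>i. (\<psi> i)\<^sup>2 * exp (lam i powr (1 / s) * ln (1 + lam i)))}"

definition gevrey_inf_norm :: "(nat \<Rightarrow> real) \<Rightarrow> real \<Rightarrow> (nat \<Rightarrow> real) \<Rightarrow> real" where
  "gevrey_inf_norm lam s \<psi> =
     sqrt (\<Sum>i. (\<psi> i)\<^sup>2 * exp (lam i powr (1 / s) * ln (1 + lam i)))"

text \<open>The last argument \<open>u'\<close> is the time derivative of \<open>u\<close>. Derivatives at \<open>0\<close> are one-sided;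
  values at negative times are irrelevant, so \<open>u\<close> and \<open>u'\<close> are unique only on \<open>{0..}\<close>.\<close>

definition very_weak_solution ::
    "(nat \<Rightarrow> real) \<Rightarrow> (real \<Rightarrow> real) \<Rightarrow> (nat \<Rightarrow> real) \<Rightarrow> (nat \<Rightarrow> real) \<Rightarrow>
     (real \<Rightarrow> nat \<Rightarrow> real) \<Rightarrow> (real \<Rightarrow> nat \<Rightarrow> real) \<Rightarrow> bool" where
  "very_weak_solution lam c u\<^sub>0 u\<^sub>1 u u' \<longleftrightarrow>
     (\<forall>i. u 0 i = u\<^sub>0 i \<and> u' 0 i = u\<^sub>1 i \<and>
       (\<exists>u''. continuous_on {0..} u'' \<and>
         (\<forall>t\<ge>0. ((\<lambda>r. u r i) has_real_derivative u' t i) (at t within {0..}) \<and>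
                ((\<lambda>r. u' r i) has_real_derivative u'' t) (at t within {0..}) \<and>
                u'' t + c t * (lam i)\<^sup>2 * u t i = 0)))"


section \<open>The metric space\<close>

text \<open>A function on \<open>[0, \<infinity>)\<close> is a function on the reals that is \<open>extensional\<close> on \<open>{0..}\<close>, so that
  functions agreeing on \<open>{0..}\<close> are equal.\<close>

definition coefficients :: "real \<Rightarrow> real \<Rightarrow> real \<Rightarrow> real \<Rightarrow> (real \<Rightarrow> real) set" where
  "coefficients \<mu>\<^sub>1 \<mu>\<^sub>2 H \<alpha> =
     {c \<in> {0..} \<rightarrow>\<^sub>E {\<mu>\<^sub>1..\<mu>\<^sub>2}. \<forall>t\<ge>0. \<forall>s\<ge>0. \<bar>c t - c s\<bar> \<le> H * \<bar>t - s\<bar> powr \<alpha>}"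

definition coefficients_dist :: "(real \<Rightarrow> real) \<Rightarrow> (real \<Rightarrow> real) \<Rightarrow> real" where
  "coefficients_dist c\<^sub>1 c\<^sub>2 = (SUP t\<in>{0..}. \<bar>c\<^sub>1 t - c\<^sub>2 t\<bar>)"

definition X_space ::
    "real \<Rightarrow> real \<Rightarrow> real \<Rightarrow> real \<Rightarrow> (nat \<Rightarrow> real) \<Rightarrow> real \<Rightarrow> ((real \<Rightarrow> real) \<times> (nat \<Rightarrow> real)) set" where
  "X_space \<mu>\<^sub>1 \<mu>\<^sub>2 H \<alpha> lam \<beta> = coefficients \<mu>\<^sub>1 \<mu>\<^sub>2 H \<alpha> \<times> gevrey_inf lam \<beta>"

text \<open>The locale \<open>Metric_space\<close> asks for nonnegativity also outside the carrier, where the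
  supremum and the sum have arbitrary values; hence the default value \<open>0\<close> there.\<close>

definition X_dist ::
    "real \<Rightarrow> real \<Rightarrow> real \<Rightarrow> real \<Rightarrow> (nat \<Rightarrow> real) \<Rightarrow> real \<Rightarrow>
     (real \<Rightarrow> real) \<times> (nat \<Rightarrow> real) \<Rightarrow> (real \<Rightarrow> real) \<times> (nat \<Rightarrow> real) \<Rightarrow> real" where
  "X_dist \<mu>\<^sub>1 \<mu>\<^sub>2 H \<alpha> lam \<beta> p q =
     (if p \<in> X_space \<mu>\<^sub>1 \<mu>\<^sub>2 H \<alpha> lam \<beta> \<and> q \<in> X_space \<mu>\<^sub>1 \<mu>\<^sub>2 H \<alpha> lam \<beta>
      then coefficients_dist (fst p) (fst q) + gevrey_inf_norm lam \<beta> (\<lambda>i. snd p i - snd q i)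
      else 0)"

definition residual_in :: "'a topology \<Rightarrow> 'a set \<Rightarrow> bool" where
  "residual_in T S \<longleftrightarrow> S \<subseteq> topspace T \<and>
     (\<exists>\<C>. countable \<C> \<and> (\<forall>C\<in>\<C>. closedin T C \<and> T interior_of C = {}) \<and>
          topspace T - S \<subseteq> \<Union>\<C>)"


section \<open>The metric space is well defined and complete\<close>

lemma weighted_l2_triangle:
  fixes w f g :: "nat \<Rightarrow> real"
  assumes w: "\<And>i. 0 \<le> w i"
    and f: "summable (\<lambda>i. (f i)\<^sup>2 * w i)" and g: "summable (\<lambda>i. (g i)\<^sup>2 * w i)"
  shows "summable (\<lambda>i. (f i + g i)\<^sup>2 * w i)"
    and "sqrt (\<Sum>i. (f i + g i)\<^sup>2 * w i) \<le> sqrt (\<Sum>i. (f i)\<^sup>2 * w i) + sqrt (\<Sum>i. (g i)\<^sup>2 * w i)"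
proof -
  let ?F = "\<Sum>i. (f i)\<^sup>2 * w i" and ?G = "\<Sum>i. (g i)\<^sup>2 * w i"
  have L: "L2_set (\<lambda>i. h i * sqrt (w i)) {..<n} = sqrt (\<Sum>i<n. (h i)\<^sup>2 * w i)" for h n
    using w by (simp add: L2_set_def power_mult_distrib)
  have *: "sqrt (\<Sum>i<n. (f i + g i)\<^sup>2 * w i) \<le> sqrt ?F + sqrt ?G" for n
  proof -
    have "sqrt (\<Sum>i<n. (f i + g i)\<^sup>2 * w i)
        \<le> sqrt (\<Sum>i<n. (f i)\<^sup>2 * w i) + sqrt (\<Sum>i<n. (g i)\<^sup>2 * w i)"
      using L2_set_triangle_ineq[of "\<lambda>i. f i * sqrt (w i)" "\<lambda>i. g i * sqrt (w i)" "{..<n}"]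
      unfolding L[symmetric] by (simp add: distrib_right)
    also have "\<dots> \<le> sqrt ?F + sqrt ?G"
      using w f g by (intro add_mono real_sqrt_le_mono sum_le_suminf) auto
    finally show ?thesis .
  qed
  have nn: "0 \<le> sqrt ?F + sqrt ?G"
    using *[of 0] by simp
  have **: "(\<Sum>i<n. (f i + g i)\<^sup>2 * w i) \<le> (sqrt ?F + sqrt ?G)\<^sup>2" for n
    using * nn real_le_rsqrt sqrt_le_D by blast
  show s: "summable (\<lambda>i. (f i + g i)\<^sup>2 * w i)"
    by (rule summableI_nonneg_bounded[OF _ **]) (use w in auto)
  have "(\<Sum>i. (f i + g i)\<^sup>2 * w i) \<le> (sqrt ?F + sqrt ?G)\<^sup>2"
    using ** s by (intro suminf_le_const) auto
  then show "sqrt (\<Sum>i. (f i + g i)\<^sup>2 * w i) \<le> sqrt ?F + sqrt ?G"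
    using nn by (simp add: real_le_lsqrt)
qed

lemma gevrey_inf_diff:
  assumes "f \<in> gevrey_inf lam s" "g \<in> gevrey_inf lam s"
  shows "(\<lambda>i. f i - g i) \<in> gevrey_inf lam s"
  using assms weighted_l2_triangle(1)[of "\<lambda>i. exp (lam i powr (1 / s) * ln (1 + lam i))" f "\<lambda>i. - g i"]
  by (simp add: gevrey_inf_def)

lemma gevrey_inf_norm_triangle:
  assumes "f \<in> gevrey_inf lam s" "g \<in> gevrey_inf lam s"
  shows "gevrey_inf_norm lam s (\<lambda>i. f i + g i) \<le> gevrey_inf_norm lam s f + gevrey_inf_norm lam s g"
  using assms weighted_l2_triangle(2)[of "\<lambda>i. exp (lam i powr (1 / s) * ln (1 + lam i))" f g]
  by (simp add: gevrey_inf_def gevrey_inf_norm_def)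

lemma gevrey_inf_norm_nonneg:
  assumes "f \<in> gevrey_inf lam s"
  shows "0 \<le> gevrey_inf_norm lam s f"
  using assms by (auto simp: gevrey_inf_norm_def gevrey_inf_def intro!: suminf_nonneg)

lemma gevrey_inf_norm_minus:
  "gevrey_inf_norm lam s (\<lambda>i. g i - f i) = gevrey_inf_norm lam s (\<lambda>i. f i - g i)"
  by (simp add: gevrey_inf_norm_def power2_commute)

lemma gevrey_inf_norm_eq_0_iff:
  assumes "f \<in> gevrey_inf lam s"
  shows "gevrey_inf_norm lam s f = 0 \<longleftrightarrow> f = (\<lambda>i. 0)"
  using assms by (auto simp: gevrey_inf_norm_def gevrey_inf_def suminf_eq_zero_iff fun_eq_iff)

lemma coefficients_dist_upper:
  assumes "c \<in> coefficients \<mu>\<^sub>1 \<mu>\<^sub>2 H \<alpha>" "d \<in> coefficients \<mu>\<^sub>1 \<mu>\<^sub>2 H \<alpha>" "t \<ge> 0"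
  shows "\<bar>c t - d t\<bar> \<le> coefficients_dist c d"
proof -
  have *: "c r \<in> {\<mu>\<^sub>1..\<mu>\<^sub>2}" "d r \<in> {\<mu>\<^sub>1..\<mu>\<^sub>2}" if "r \<ge> 0" for r
    using assms that unfolding coefficients_def by (auto simp: PiE_iff)
  have "bdd_above ((\<lambda>t. \<bar>c t - d t\<bar>) ` {0..})"
    by (rule bdd_aboveI2[where M = "\<mu>\<^sub>2 - \<mu>\<^sub>1"]) (use * in \<open>fastforce simp: abs_le_iff\<close>)
  then show ?thesis
    unfolding coefficients_dist_def using assms(3) by (intro cSUP_upper) auto
qed

lemma coefficients_dist_least:
  assumes "\<And>t. t \<ge> 0 \<Longrightarrow> \<bar>c t - d t\<bar> \<le> K"
  shows "coefficients_dist c d \<le> K"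
  unfolding coefficients_dist_def using assms by (intro cSUP_least) auto

lemma coefficients_dist_nonneg:
  assumes "c \<in> coefficients \<mu>\<^sub>1 \<mu>\<^sub>2 H \<alpha>" "d \<in> coefficients \<mu>\<^sub>1 \<mu>\<^sub>2 H \<alpha>"
  shows "0 \<le> coefficients_dist c d"
  using coefficients_dist_upper[OF assms, of 0] by simp

lemma coefficients_dist_commute: "coefficients_dist d c = coefficients_dist c d"
  by (simp add: coefficients_dist_def abs_minus_commute)

lemma coefficients_dist_eq_0_iff:
  assumes "c \<in> coefficients \<mu>\<^sub>1 \<mu>\<^sub>2 H \<alpha>" "d \<in> coefficients \<mu>\<^sub>1 \<mu>\<^sub>2 H \<alpha>"
  shows "coefficients_dist c d = 0 \<longleftrightarrow> c = d"
proof
  assume "coefficients_dist c d = 0"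
  then have "c t = d t" if "t \<ge> 0" for t
    using coefficients_dist_upper[OF assms that] by simp
  then show "c = d"
    using assms by (intro extensionalityI[of c "{0..}"]) (auto simp: coefficients_def PiE_def)
qed (simp add: coefficients_dist_def)

lemma Metric_space_X: "Metric_space (X_space \<mu>\<^sub>1 \<mu>\<^sub>2 H \<alpha> lam \<beta>) (X_dist \<mu>\<^sub>1 \<mu>\<^sub>2 H \<alpha> lam \<beta>)"
proof
  let ?X = "X_space \<mu>\<^sub>1 \<mu>\<^sub>2 H \<alpha> lam \<beta>" and ?d = "X_dist \<mu>\<^sub>1 \<mu>\<^sub>2 H \<alpha> lam \<beta>"
  fix p q r
  show "0 \<le> ?d p q"
    by (auto simp: X_dist_def X_space_def
        intro!: add_nonneg_nonneg coefficients_dist_nonneg gevrey_inf_norm_nonneg gevrey_inf_diff)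
  show "?d p q = ?d q p"
    by (simp add: X_dist_def coefficients_dist_commute[of "fst p"]
        gevrey_inf_norm_minus[of _ _ "snd p"])
  show "?d p q = 0 \<longleftrightarrow> p = q" if pq: "p \<in> ?X" "q \<in> ?X"
  proof -
    have m: "fst p \<in> coefficients \<mu>\<^sub>1 \<mu>\<^sub>2 H \<alpha>" "fst q \<in> coefficients \<mu>\<^sub>1 \<mu>\<^sub>2 H \<alpha>"
      "(\<lambda>i. snd p i - snd q i) \<in> gevrey_inf lam \<beta>"
      using pq by (auto simp: X_space_def intro: gevrey_inf_diff)
    show ?thesis
      using pq coefficients_dist_nonneg[OF m(1,2)] gevrey_inf_norm_nonneg[OF m(3)]
        coefficients_dist_eq_0_iff[OF m(1,2)] gevrey_inf_norm_eq_0_iff[OF m(3)]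
      by (auto simp: X_dist_def add_nonneg_eq_0_iff prod_eq_iff fun_eq_iff)
  qed
  show "?d p r \<le> ?d p q + ?d q r" if pqr: "p \<in> ?X" "q \<in> ?X" "r \<in> ?X"
  proof -
    have m: "fst p \<in> coefficients \<mu>\<^sub>1 \<mu>\<^sub>2 H \<alpha>" "fst q \<in> coefficients \<mu>\<^sub>1 \<mu>\<^sub>2 H \<alpha>"
      "fst r \<in> coefficients \<mu>\<^sub>1 \<mu>\<^sub>2 H \<alpha>"
      "(\<lambda>i. snd p i - snd q i) \<in> gevrey_inf lam \<beta>" "(\<lambda>i. snd q i - snd r i) \<in> gevrey_inf lam \<beta>"
      using pqr by (auto simp: X_space_def intro: gevrey_inf_diff)
    have "coefficients_dist (fst p) (fst r)
        \<le> coefficients_dist (fst p) (fst q) + coefficients_dist (fst q) (fst r)"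
    proof (rule coefficients_dist_least)
      fix t :: real assume "t \<ge> 0"
      then show "\<bar>fst p t - fst r t\<bar>
          \<le> coefficients_dist (fst p) (fst q) + coefficients_dist (fst q) (fst r)"
        using coefficients_dist_upper[OF m(1,2)] coefficients_dist_upper[OF m(2,3)] by fastforce
    qed
    then show ?thesis
      using pqr gevrey_inf_norm_triangle[OF m(4,5)] by (simp add: X_dist_def)
  qed
qed

lemma gevrey_inf_limit:
  assumes fG: "\<And>n. f n \<in> gevrey_inf lam s"
    and bd: "\<And>m. m \<ge> N \<Longrightarrow> gevrey_inf_norm lam s (\<lambda>i. f n i - f m i) \<le> K"
    and lim: "\<And>i. (\<lambda>m. f m i) \<longlonglongrightarrow> g i"
  shows "g \<in> gevrey_inf lam s" and "gevrey_inf_norm lam s (\<lambda>i. f n i - g i) \<le> K"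
proof -
  define w where "w = (\<lambda>i. exp (lam i powr (1 / s) * ln (1 + lam i)))"
  have w: "w i \<ge> 0" for i
    by (simp add: w_def)
  have K: "K \<ge> 0"
    using bd[of N] gevrey_inf_norm_nonneg[OF gevrey_inf_diff[OF fG fG], of n N] by simp
  have part: "(\<Sum>i<k. (f n i - f m i)\<^sup>2 * w i) \<le> K\<^sup>2" if "m \<ge> N" for m k
  proof -
    have "(\<Sum>i<k. (f n i - f m i)\<^sup>2 * w i) \<le> (\<Sum>i. (f n i - f m i)\<^sup>2 * w i)"
      using gevrey_inf_diff[OF fG fG, of n m] w
      by (intro sum_le_suminf) (auto simp: gevrey_inf_def w_def)
    also have "\<dots> \<le> K\<^sup>2"
      using bd[OF that] by (intro sqrt_le_D) (simp add: gevrey_inf_norm_def w_def)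
    finally show ?thesis .
  qed
  have part': "(\<Sum>i<k. (f n i - g i)\<^sup>2 * w i) \<le> K\<^sup>2" for k
  proof (rule LIMSEQ_le_const2)
    show "(\<lambda>m. \<Sum>i<k. (f n i - f m i)\<^sup>2 * w i) \<longlonglongrightarrow> (\<Sum>i<k. (f n i - g i)\<^sup>2 * w i)"
      by (intro tendsto_intros lim)
  qed (use part in blast)
  have sm: "summable (\<lambda>i. (f n i - g i)\<^sup>2 * w i)"
    by (rule summableI_nonneg_bounded[OF _ part']) (use w in auto)
  then have "(\<lambda>i. f n i - g i) \<in> gevrey_inf lam s"
    by (simp add: gevrey_inf_def w_def)
  from gevrey_inf_diff[OF fG[of n] this] show "g \<in> gevrey_inf lam s"
    by simp
  have "(\<Sum>i. (f n i - g i)\<^sup>2 * w i) \<le> K\<^sup>2"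
    using part' sm by (intro suminf_le_const) auto
  then show "gevrey_inf_norm lam s (\<lambda>i. f n i - g i) \<le> K"
    using K by (simp add: gevrey_inf_norm_def w_def real_le_lsqrt)
qed

lemma gevrey_inf_coordinate_le:
  assumes "f \<in> gevrey_inf lam s"
  shows "\<bar>f i\<bar> * sqrt (exp (lam i powr (1 / s) * ln (1 + lam i))) \<le> gevrey_inf_norm lam s f"
proof -
  let ?w = "\<lambda>i. exp (lam i powr (1 / s) * ln (1 + lam i))"
  have "(\<Sum>i\<in>{i}. (f i)\<^sup>2 * ?w i) \<le> (\<Sum>i. (f i)\<^sup>2 * ?w i)"
    using assms by (intro sum_le_suminf) (auto simp: gevrey_inf_def)
  then have "sqrt ((f i)\<^sup>2 * ?w i) \<le> gevrey_inf_norm lam s f"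
    by (simp add: gevrey_inf_norm_def)
  then show ?thesis
    by (simp add: real_sqrt_mult)
qed

lemma coefficients_limit:
  assumes cC: "\<And>n. c n \<in> coefficients \<mu>\<^sub>1 \<mu>\<^sub>2 H \<alpha>"
    and lim: "\<And>t. t \<ge> 0 \<Longrightarrow> (\<lambda>n. c n t) \<longlonglongrightarrow> d t"
    and ext: "d \<in> extensional {0..}"
  shows "d \<in> coefficients \<mu>\<^sub>1 \<mu>\<^sub>2 H \<alpha>"
proof -
  have c: "\<mu>\<^sub>1 \<le> c n t" "c n t \<le> \<mu>\<^sub>2" if "t \<ge> 0" for n t
    using cC[of n] that unfolding coefficients_def by (auto simp: PiE_iff)
  have "\<mu>\<^sub>1 \<le> d t" "d t \<le> \<mu>\<^sub>2" if "t \<ge> 0" for t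
    using c[OF that] lim[OF that] by (auto intro: LIMSEQ_le_const LIMSEQ_le_const2)
  moreover have "\<bar>d t - d s\<bar> \<le> H * \<bar>t - s\<bar> powr \<alpha>" if "t \<ge> 0" "s \<ge> 0" for t s
  proof (rule LIMSEQ_le_const2)
    show "(\<lambda>n. \<bar>c n t - c n s\<bar>) \<longlonglongrightarrow> \<bar>d t - d s\<bar>"
      by (intro tendsto_intros lim that)
    show "\<exists>N. \<forall>n\<ge>N. \<bar>c n t - c n s\<bar> \<le> H * \<bar>t - s\<bar> powr \<alpha>"
      using cC that by (auto simp: coefficients_def)
  qed
  ultimately show ?thesis
    using ext by (auto simp: coefficients_def PiE_iff)
qed

lemma mcomplete_X:
  "Metric_space.mcomplete (X_space \<mu>\<^sub>1 \<mu>\<^sub>2 H \<alpha> lam \<beta>) (X_dist \<mu>\<^sub>1 \<mu>\<^sub>2 H \<alpha> lam \<beta>)"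
proof -
  let ?X = "X_space \<mu>\<^sub>1 \<mu>\<^sub>2 H \<alpha> lam \<beta>" and ?d = "X_dist \<mu>\<^sub>1 \<mu>\<^sub>2 H \<alpha> lam \<beta>"
  interpret X: Metric_space ?X ?d
    by (rule Metric_space_X)
  have "\<exists>x. limitin X.mtopology \<sigma> x sequentially" if C: "X.MCauchy \<sigma>" for \<sigma>
  proof -
    define c f where "c = (\<lambda>n. fst (\<sigma> n))" and "f = (\<lambda>n. snd (\<sigma> n))"
    define c' f' where "c' = restrict (\<lambda>t. lim (\<lambda>n. c n t)) {0..}" and "f' = (\<lambda>i. lim (\<lambda>n. f n i))"
    have \<sigma>X: "\<sigma> n \<in> ?X" for n
      using C by (auto simp: X.MCauchy_def)
    then have cC: "c n \<in> coefficients \<mu>\<^sub>1 \<mu>\<^sub>2 H \<alpha>" and fG: "f n \<in> gevrey_inf lam \<beta>" for n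
      by (auto simp: c_def f_def X_space_def mem_Times_iff)
    have d: "?d (\<sigma> n) (\<sigma> m) =
        coefficients_dist (c n) (c m) + gevrey_inf_norm lam \<beta> (\<lambda>i. f n i - f m i)" for n m
      using \<sigma>X by (simp add: X_dist_def c_def f_def)
    have le: "coefficients_dist (c n) (c m) \<le> ?d (\<sigma> n) (\<sigma> m)"
      "gevrey_inf_norm lam \<beta> (\<lambda>i. f n i - f m i) \<le> ?d (\<sigma> n) (\<sigma> m)" for n m
      using coefficients_dist_nonneg[OF cC cC, of n m]
        gevrey_inf_norm_nonneg[OF gevrey_inf_diff[OF fG fG], of n m]
      by (simp_all add: d)
    have Cauchy: "\<exists>N. \<forall>n\<ge>N. \<forall>m\<ge>N. ?d (\<sigma> n) (\<sigma> m) < \<epsilon>" if "\<epsilon> > 0" for \<epsilon>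
      using C that by (simp add: X.MCauchy_def)
    have "convergent (\<lambda>n. c n t)" if "t \<ge> 0" for t
    proof (rule Cauchy_convergent, rule metric_CauchyI)
      fix \<epsilon> :: real assume "\<epsilon> > 0"
      from Cauchy[OF this] obtain N where N: "\<forall>n\<ge>N. \<forall>m\<ge>N. ?d (\<sigma> n) (\<sigma> m) < \<epsilon>" ..
      have "dist (c m t) (c n t) < \<epsilon>" if "m \<ge> N" "n \<ge> N" for m n
      proof -
        have "?d (\<sigma> m) (\<sigma> n) < \<epsilon>"
          using N that by blast
        then show ?thesis
          using coefficients_dist_upper[OF cC cC \<open>t \<ge> 0\<close>, of m n] le(1)[of m n]
          by (simp add: dist_real_def)
      qed
      then show "\<exists>N. \<forall>m\<ge>N. \<forall>n\<ge>N. dist (c m t) (c n t) < \<epsilon>"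
        by blast
    qed
    then have cl: "(\<lambda>n. c n t) \<longlonglongrightarrow> c' t" if "t \<ge> 0" for t
      using that by (simp add: c'_def convergent_LIMSEQ_iff)
    have "convergent (\<lambda>n. f n i)" for i
    proof (rule Cauchy_convergent, rule metric_CauchyI)
      fix \<epsilon> :: real assume \<epsilon>: "\<epsilon> > 0"
      define w where "w = sqrt (exp (lam i powr (1 / \<beta>) * ln (1 + lam i)))"
      have w: "w > 0"
        by (simp add: w_def)
      then obtain N where N: "\<forall>n\<ge>N. \<forall>m\<ge>N. ?d (\<sigma> n) (\<sigma> m) < \<epsilon> * w"
        using Cauchy[of "\<epsilon> * w"] \<epsilon> by auto
      have "dist (f m i) (f n i) < \<epsilon>" if "m \<ge> N" "n \<ge> N" for m n
      proof -
        have "\<bar>f m i - f n i\<bar> * w \<le> ?d (\<sigma> m) (\<sigma> n)"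
          using gevrey_inf_coordinate_le[OF gevrey_inf_diff[OF fG[of m] fG[of n]], of i] le(2)[of m n]
          by (simp add: w_def)
        also have "\<dots> < \<epsilon> * w"
          using N that by blast
        finally show ?thesis
          using w by (simp add: dist_real_def)
      qed
      then show "\<exists>N. \<forall>m\<ge>N. \<forall>n\<ge>N. dist (f m i) (f n i) < \<epsilon>"
        by blast
    qed
    then have fl: "(\<lambda>n. f n i) \<longlonglongrightarrow> f' i" for i
      by (simp add: f'_def convergent_LIMSEQ_iff)
    have c'C: "c' \<in> coefficients \<mu>\<^sub>1 \<mu>\<^sub>2 H \<alpha>"
      by (rule coefficients_limit[OF cC cl]) (simp_all add: c'_def extensional_def)
    have bound: "f' \<in> gevrey_inf lam \<beta> \<and>
        coefficients_dist (c n) c' + gevrey_inf_norm lam \<beta> (\<lambda>i. f n i - f' i) \<le> \<epsilon> + \<epsilon>"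
      if N: "\<forall>n\<ge>N. \<forall>m\<ge>N. ?d (\<sigma> n) (\<sigma> m) < \<epsilon>" and n: "n \<ge> N" for N n \<epsilon>
    proof -
      have a: "coefficients_dist (c n) (c m) \<le> \<epsilon>"
        "gevrey_inf_norm lam \<beta> (\<lambda>i. f n i - f m i) \<le> \<epsilon>" if "m \<ge> N" for m
      proof -
        have "?d (\<sigma> n) (\<sigma> m) < \<epsilon>"
          using N n that by blast
        then show "coefficients_dist (c n) (c m) \<le> \<epsilon>"
          "gevrey_inf_norm lam \<beta> (\<lambda>i. f n i - f m i) \<le> \<epsilon>"
          using le[of n m] by simp_all
      qed
      have "coefficients_dist (c n) c' \<le> \<epsilon>"
      proof (rule coefficients_dist_least)
        fix t :: real assume t: "t \<ge> 0"
        show "\<bar>c n t - c' t\<bar> \<le> \<epsilon>"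
        proof (rule LIMSEQ_le_const2)
          show "(\<lambda>m. \<bar>c n t - c m t\<bar>) \<longlonglongrightarrow> \<bar>c n t - c' t\<bar>"
            by (intro tendsto_intros cl t)
          show "\<exists>N. \<forall>m\<ge>N. \<bar>c n t - c m t\<bar> \<le> \<epsilon>"
            using a(1) coefficients_dist_upper[OF cC cC t, of n] order_trans by blast
        qed
      qed
      moreover have "f' \<in> gevrey_inf lam \<beta>" "gevrey_inf_norm lam \<beta> (\<lambda>i. f n i - f' i) \<le> \<epsilon>"
        using gevrey_inf_limit[OF fG a(2) fl] by blast+
      ultimately show ?thesis
        by simp
    qed
    obtain N0 where "\<forall>n\<ge>N0. \<forall>m\<ge>N0. ?d (\<sigma> n) (\<sigma> m) < 1"
      using Cauchy[of 1] by auto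
    then have f'G: "f' \<in> gevrey_inf lam \<beta>"
      using bound by blast
    then have X': "(c', f') \<in> ?X"
      using c'C by (simp add: X_space_def)
    have "limitin X.mtopology \<sigma> (c', f') sequentially"
      unfolding X.limit_metric_sequentially
    proof (intro conjI allI impI)
      fix \<epsilon> :: real assume "\<epsilon> > 0"
      then obtain N where N: "\<forall>n\<ge>N. \<forall>m\<ge>N. ?d (\<sigma> n) (\<sigma> m) < \<epsilon> / 3"
        using Cauchy[of "\<epsilon> / 3"] by auto
      have "?d (\<sigma> n) (c', f') < \<epsilon>" if "n \<ge> N" for n
        using bound[OF N that] \<sigma>X[of n] X' \<open>\<epsilon> > 0\<close> by (simp add: X_dist_def c_def f_def)
      then show "\<exists>N. \<forall>n\<ge>N. \<sigma> n \<in> ?X \<and> ?d (\<sigma> n) (c', f') < \<epsilon>"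
        using \<sigma>X by blast
    qed (rule X')
    then show ?thesis ..
  qed
  then show ?thesis
    by (simp add: X.mcomplete_def)
qed

end

(*
  If the pair (c, psi) is not in the set, then for some t > 0 the modes of its solution at time t are
  bounded by sqrt k exp(k lam_i^(1/B)) for some k, and t lies in [1/k, k]. For fixed k the pairs with
  this property form a closed set, because each mode depends continuously on the data and [1/k, k]
  is compact. This closed set has empty interior: every coefficient is close to a C^1 one that is
  constant, say gamma^2, near t = 0 and has Hoelder constant below H; adding an oscillation of
  amplitude of order lam^(-alpha) and frequency 2 gamma lam on the initial interval makes the mode
  of frequency lam grow like exp(kappa lam^(1-alpha)) there, and on the remaining interval the C^1
  coefficient costs only a factor independent of lam. Choosing lam = lam_i large, the growth beats
  both exp(k lam^(1/B)) and the smallness exp(-lam^(1/beta) log(1+lam)/2) of the perturbation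
  needed to excite that mode in psi.
*)
theory Submission
  imports Defs "HOL-Real_Asymp.Real_Asymp"
begin

text \<open>The thresholds on B and \<beta> come from one exponent. At frequency lam the Hoelder
  constraint allows oscillations of size lam^(-\<alpha>); they feed the mode at rate lam *
  lam^(-\<alpha>) = lam^(1-\<alpha>), and the hypotheses say that 1/B and 1/\<beta> lie below
  1-\<alpha>. For a coefficient that is merely Hoelder, later energy estimates would allow a loss of
  this same order; a bounded derivative is what makes the energy rate free of lam. So the
  coefficient is first smoothed and pulled away from the limits set by its range and by H, and lam
  is chosen only after the constants of this step are fixed. The constant initial stretch is
  obtained by delaying the smoothed coefficient. Tameness is demanded of each mode separately, so
  spoiling one mode suffices and only one component of psi has to be moved.\<close>

section \<open>The equation of a single mode\<close>

text \<open>The factor \<open>l\<^sup>2\<close> is absorbed in \<open>q\<close>, which keeps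
  existence, uniqueness and stability free of the frequency. Derivatives are taken within
  \<open>S\<close>: they are one-sided at end points, so solutions restrict to subintervals.\<close>

definition solves_on :: "real set \<Rightarrow> (real \<Rightarrow> real) \<Rightarrow> (real \<Rightarrow> real) \<Rightarrow> (real \<Rightarrow> real) \<Rightarrow> bool" where
  "solves_on S q u u' \<longleftrightarrow>
     (\<forall>t\<in>S. (u has_real_derivative u' t) (at t within S) \<and>
            (u' has_real_derivative - (q t * u t)) (at t within S))"

lemma solves_on_subset: "solves_on S q u u' \<Longrightarrow> T \<subseteq> S \<Longrightarrow> solves_on T q u u'"
  unfolding solves_on_def by (meson DERIV_subset subsetD)

lemma has_real_derivative_nonneg_imp_le:
  fixes f :: "real \<Rightarrow> real"
  assumes "a \<le> b"
    and "\<And>t. t \<in> {a..b} \<Longrightarrow> (f has_real_derivative f' t) (at t within {a..b})"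
    and "\<And>t. t \<in> {a..b} \<Longrightarrow> 0 \<le> f' t"
  shows "f a \<le> f b"
proof (cases "a = b")
  case False
  then have "a < b" using assms(1) by simp
  then obtain x where x: "x \<in> {a<..<b}" "f b - f a = f' x * (b - a)"
    using mvt_simple[of a b f "\<lambda>x. (*) (f' x)"] assms(2)
    by (auto simp: has_field_derivative_def)
  then have "0 \<le> f' x * (b - a)"
    using assms(3)[of x] \<open>a < b\<close> by (intro mult_nonneg_nonneg) auto
  then show ?thesis using x by linarith
qed simp

section \<open>Gronwall inequalities and energy estimates\<close>

lemma gronwall_lower:
  fixes f :: "real \<Rightarrow> real"
  assumes "a \<le> b"
    and "\<And>t. t \<in> {a..b} \<Longrightarrow> (f has_real_derivative f' t) (at t within {a..b})"
    and "\<And>t. t \<in> {a..b} \<Longrightarrow> - L * f t \<le> f' t"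
  shows "f a * exp (- L * (b - a)) \<le> f b"
proof -
  define g where "g = (\<lambda>t. f t * exp (L * (t - a)))"
  have "g a \<le> g b"
  proof (rule has_real_derivative_nonneg_imp_le[OF assms(1)])
    fix t assume t: "t \<in> {a..b}"
    show "(g has_real_derivative (f' t + L * f t) * exp (L * (t - a))) (at t within {a..b})"
      unfolding g_def
      by (rule derivative_eq_intros assms(2)[OF t] refl)+ (simp add: algebra_simps)
    show "0 \<le> (f' t + L * f t) * exp (L * (t - a))"
      using assms(3)[OF t] by (intro mult_nonneg_nonneg) auto
  qed
  then have "f a * exp (- L * (b - a)) \<le> f b * exp (L * (b - a)) * exp (- L * (b - a))"
    by (intro mult_right_mono) (auto simp: g_def)
  also have "\<dots> = f b"
    by (simp add: mult.assoc flip: exp_add)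
  finally show ?thesis .
qed

lemma gronwall_upper:
  fixes f :: "real \<Rightarrow> real"
  assumes "0 \<le> T" "0 \<le> A" "0 \<le> C"
    and "\<And>t. t \<in> {0..T} \<Longrightarrow> (f has_real_derivative f' t) (at t within {0..T})"
    and "\<And>t. t \<in> {0..T} \<Longrightarrow> f' t \<le> A * f t + C"
  shows "f T \<le> (f 0 + C * T) * exp (A * T)"
proof -
  \<comment> \<open>Since \<open>exp (- A * t)\<close> is at most 1, the inhomogeneity is bounded by
    \<open>C\<close>; this is cruder than the exact comparison solution but avoids dividing by
    \<open>A\<close>, which may vanish.\<close>
  define g where "g = (\<lambda>t. C * t - f t * exp (- A * t))"
  have "g 0 \<le> g T"
  proof (rule has_real_derivative_nonneg_imp_le[OF assms(1)])
    fix t assume t: "t \<in> {0..T}"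
    show "(g has_real_derivative C - (f' t - A * f t) * exp (- A * t)) (at t within {0..T})"
      unfolding g_def
      by (rule derivative_eq_intros assms(4)[OF t] refl)+ (simp add: algebra_simps)
    have "(f' t - A * f t) * exp (- A * t) \<le> C * exp (- A * t)"
      using assms(5)[OF t] by (intro mult_right_mono) auto
    also have "\<dots> \<le> C"
      using assms(1-3) t by (intro mult_left_le) auto
    finally show "0 \<le> C - (f' t - A * f t) * exp (- A * t)"
      by simp
  qed
  then have "f T * exp (- A * T) * exp (A * T) \<le> (f 0 + C * T) * exp (A * T)"
    by (intro mult_right_mono) (auto simp: g_def)
  then show ?thesis
    by (simp add: mult.assoc flip: exp_add)
qed

text \<open>With the weight \<open>l\<^sup>2 * c t\<close> on \<open>u\<close>, the energy
  \<open>E\<close> changes only through \<open>c'\<close>, and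
  \<open>\<bar>c' t\<bar> \<le> L\<close> gives the rate \<open>L / \<mu>\<^sub>1\<close>, which
  does not contain \<open>l\<close>. The price is a polynomial factor when \<open>E\<close> is
  compared with the unweighted sum at \<open>b\<close>.\<close>

lemma solution_growth_lower:
  assumes sol: "solves_on {a..b} (\<lambda>t. l\<^sup>2 * c t) u u'" and "a \<le> b"
    and c': "\<And>t. t \<in> {a..b} \<Longrightarrow> (c has_real_derivative c' t) (at t within {a..b})"
    and c'_le: "\<And>t. t \<in> {a..b} \<Longrightarrow> \<bar>c' t\<bar> \<le> L"
    and c: "\<And>t. t \<in> {a..b} \<Longrightarrow> \<mu>\<^sub>1 \<le> c t" "\<And>t. t \<in> {a..b} \<Longrightarrow> c t \<le> \<mu>\<^sub>2"
    and "0 < \<mu>\<^sub>1"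
  shows "(u' a)\<^sup>2 * exp (- (L / \<mu>\<^sub>1) * (b - a)) \<le> (1 + l\<^sup>2 * \<mu>\<^sub>2) * ((u b)\<^sup>2 + (u' b)\<^sup>2)"
proof -
  define E where "E = (\<lambda>t. (u' t)\<^sup>2 + l\<^sup>2 * c t * (u t)\<^sup>2)"
  have ab: "a \<in> {a..b}" "b \<in> {a..b}" using \<open>a \<le> b\<close> by auto
  have "0 \<le> L" using c'_le[OF ab(1)] by linarith
  have "E a * exp (- (L / \<mu>\<^sub>1) * (b - a)) \<le> E b"
  proof (rule gronwall_lower[OF \<open>a \<le> b\<close>])
    fix t assume t: "t \<in> {a..b}"
    have d: "(u has_real_derivative u' t) (at t within {a..b})"
      "(u' has_real_derivative - (l\<^sup>2 * c t * u t)) (at t within {a..b})"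
      using sol t by (auto simp: solves_on_def)
    show "(E has_real_derivative l\<^sup>2 * c' t * (u t)\<^sup>2) (at t within {a..b})"
      unfolding E_def
      by (rule derivative_eq_intros d c'[OF t] refl)+ (simp add: algebra_simps)
    have "\<bar>c' t\<bar> * \<mu>\<^sub>1 \<le> L * c t"
      using c'_le[OF t] c(1)[OF t] \<open>0 < \<mu>\<^sub>1\<close> \<open>0 \<le> L\<close> by (intro mult_mono) auto
    moreover have "- c' t * \<mu>\<^sub>1 \<le> \<bar>c' t\<bar> * \<mu>\<^sub>1"
      using \<open>0 < \<mu>\<^sub>1\<close> by (intro mult_right_mono) auto
    ultimately have "- (L * c t) \<le> c' t * \<mu>\<^sub>1"
      by linarith
    then have "- (L / \<mu>\<^sub>1) * c t \<le> c' t"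
      using \<open>0 < \<mu>\<^sub>1\<close> by (simp add: field_simps)
    then have "(l\<^sup>2 * (u t)\<^sup>2) * (- (L / \<mu>\<^sub>1) * c t) \<le> (l\<^sup>2 * (u t)\<^sup>2) * c' t"
      by (intro mult_left_mono) auto
    moreover have "0 \<le> L / \<mu>\<^sub>1 * (u' t)\<^sup>2"
      using \<open>0 \<le> L\<close> \<open>0 < \<mu>\<^sub>1\<close> by simp
    ultimately show "- (L / \<mu>\<^sub>1) * E t \<le> l\<^sup>2 * c' t * (u t)\<^sup>2"
      unfolding E_def by (simp add: algebra_simps)
  qed
  moreover have "(u' a)\<^sup>2 \<le> E a"
    using c(1)[OF ab(1)] \<open>0 < \<mu>\<^sub>1\<close> by (simp add: E_def)
  moreover have "E b \<le> (1 + l\<^sup>2 * \<mu>\<^sub>2) * ((u b)\<^sup>2 + (u' b)\<^sup>2)"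
  proof -
    have "l\<^sup>2 * c b * (u b)\<^sup>2 \<le> l\<^sup>2 * \<mu>\<^sub>2 * (u b)\<^sup>2"
      using c(2)[OF ab(2)] by (intro mult_right_mono mult_left_mono) auto
    moreover have "0 \<le> l\<^sup>2 * \<mu>\<^sub>2 * (u' b)\<^sup>2"
      using c[OF ab(2)] \<open>0 < \<mu>\<^sub>1\<close> by simp
    ultimately show ?thesis
      using zero_le_power2[of "u b"] unfolding E_def distrib_left distrib_right mult_1_left
      by linarith
  qed
  ultimately show ?thesis
    by (smt (verit) mult_right_mono exp_ge_zero)
qed

text \<open>The difference solves the equation with coefficient \<open>q\<close> and forcing
  \<open>- (q - r) * v\<close>. A bound is asked of \<open>v\<close> only, so \<open>v\<close> can
  stay fixed while \<open>u\<close> runs through a sequence; \<open>\<epsilon> = 0\<close> gives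
  uniqueness.\<close>

lemma solution_difference:
  assumes u: "solves_on {0..T} q u u'" and v: "solves_on {0..T} r v v'" and "0 \<le> T"
    and q: "\<And>t. t \<in> {0..T} \<Longrightarrow> \<bar>q t\<bar> \<le> M"
    and qr: "\<And>t. t \<in> {0..T} \<Longrightarrow> \<bar>q t - r t\<bar> \<le> \<epsilon>"
    and V: "\<And>t. t \<in> {0..T} \<Longrightarrow> \<bar>v t\<bar> \<le> V"
  shows "(u T - v T)\<^sup>2 + (u' T - v' T)\<^sup>2 \<le>
    ((u 0 - v 0)\<^sup>2 + (u' 0 - v' 0)\<^sup>2 + \<epsilon>\<^sup>2 * V\<^sup>2 * T) * exp ((2 + M) * T)"
proof -
  define E where "E = (\<lambda>t. (u t - v t)\<^sup>2 + (u' t - v' t)\<^sup>2)"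
  have "0 \<le> M" using q[of 0] \<open>0 \<le> T\<close> by auto
  have "E T \<le> (E 0 + \<epsilon>\<^sup>2 * V\<^sup>2 * T) * exp ((2 + M) * T)"
  proof (rule gronwall_upper[OF \<open>0 \<le> T\<close>])
    fix t assume t: "t \<in> {0..T}"
    have d: "(u has_real_derivative u' t) (at t within {0..T})"
      "(u' has_real_derivative - (q t * u t)) (at t within {0..T})"
      "(v has_real_derivative v' t) (at t within {0..T})"
      "(v' has_real_derivative - (r t * v t)) (at t within {0..T})"
      using u v t by (auto simp: solves_on_def)
    define w w' p where "w = u t - v t" and "w' = u' t - v' t" and "p = (q t - r t) * v t"
    show "(E has_real_derivative 2 * w * w' - 2 * q t * (w * w') - 2 * p * w') (at t within {0..T})"
      unfolding E_def w_def w'_def p_def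
      by (rule derivative_eq_intros d refl)+ (simp add: algebra_simps)
    have "\<bar>p\<bar> \<le> \<epsilon> * V"
      unfolding p_def abs_mult using qr[OF t] V[OF t] by (intro mult_mono) auto
    then have "p\<^sup>2 \<le> (\<epsilon> * V)\<^sup>2"
      using power_mono[of "\<bar>p\<bar>" "\<epsilon> * V" 2] by simp
    moreover have "- (2 * p * w') \<le> p\<^sup>2 + w'\<^sup>2"
      using zero_le_power2[of "p + w'"] by (simp add: power2_sum)
    moreover have ww: "2 * \<bar>w * w'\<bar> \<le> w\<^sup>2 + w'\<^sup>2"
      using zero_le_power2[of "\<bar>w\<bar> - \<bar>w'\<bar>"] by (simp add: power2_diff abs_mult)
    moreover have "2 * w * w' \<le> 2 * \<bar>w * w'\<bar>"
      by simp
    moreover have "- (2 * q t * (w * w')) \<le> M * (w\<^sup>2 + w'\<^sup>2)"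
    proof -
      have "- (2 * q t * (w * w')) \<le> \<bar>q t\<bar> * (2 * \<bar>w * w'\<bar>)"
        using abs_ge_minus_self[of "q t * (w * w')"] abs_mult[of "q t" "w * w'"] by linarith
      also have "\<dots> \<le> M * (w\<^sup>2 + w'\<^sup>2)"
        using q[OF t] ww \<open>0 \<le> M\<close> by (intro mult_mono) auto
      finally show ?thesis .
    qed
    ultimately have "2 * w * w' - 2 * q t * (w * w') - 2 * p * w' \<le>
        (w\<^sup>2 + w'\<^sup>2) + M * (w\<^sup>2 + w'\<^sup>2) + (w'\<^sup>2 + (\<epsilon> * V)\<^sup>2)"
      by linarith
    also have "\<dots> \<le> (2 + M) * E t + \<epsilon>\<^sup>2 * V\<^sup>2"
      unfolding E_def w_def[symmetric] w'_def[symmetric] by (simp add: algebra_simps power_mult_distrib)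
    finally show "2 * w * w' - 2 * q t * (w * w') - 2 * p * w' \<le> (2 + M) * E t + \<epsilon>\<^sup>2 * V\<^sup>2" .
  qed (use \<open>0 \<le> M\<close> in auto)
  then show ?thesis by (simp add: E_def)
qed

lemma solves_on_continuous:
  assumes "solves_on S q u u'"
  shows "continuous_on S u" "continuous_on S u'"
  using assms unfolding solves_on_def continuous_on_eq_continuous_within
  by (meson DERIV_continuous)+

lemma solution_unique:
  assumes u: "solves_on {0..T} q u u'" and v: "solves_on {0..T} q v v'"
    and "u 0 = v 0" "u' 0 = v' 0" and "0 \<le> T"
    and q: "\<And>t. t \<in> {0..T} \<Longrightarrow> \<bar>q t\<bar> \<le> M"
  shows "u T = v T" "u' T = v' T"
proof -
  have "bounded (v ` {0..T})"
    using solves_on_continuous(1)[OF v] by (intro compact_imp_bounded compact_continuous_image) auto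
  then obtain V where V: "\<And>t. t \<in> {0..T} \<Longrightarrow> \<bar>v t\<bar> \<le> V"
    unfolding bounded_iff by fastforce
  have "(u T - v T)\<^sup>2 + (u' T - v' T)\<^sup>2 \<le> 0"
    using solution_difference[OF u v \<open>0 \<le> T\<close> q _ V, of 0] assms(3,4) by simp
  then have "(u T - v T)\<^sup>2 + (u' T - v' T)\<^sup>2 = 0"
    by (smt (verit) zero_le_power2)
  then show "u T = v T" "u' T = v' T"
    by (simp_all add: sum_power2_eq_zero_iff)
qed

section \<open>Existence by Picard iteration\<close>

lemma has_real_derivative_transform_on:
  fixes f g :: "real \<Rightarrow> real"
  assumes "(g has_real_derivative D) (at t within S)" "t \<in> S" "\<And>s. s \<in> S \<Longrightarrow> f s = g s"
  shows "(f has_real_derivative D) (at t within S)"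
  using assms(1) unfolding has_field_derivative_def
  by (rule has_derivative_transform[OF assms(2,3), rotated]) simp

text \<open>The even terms sum up to \<open>u'\<close> and the odd ones to \<open>u\<close>, where \<open>u'' = - q u\<close>, \<open>u 0 = 0\<close> and
  \<open>u' 0 = y\<close>.\<close>

primrec picard :: "(real \<Rightarrow> real) \<Rightarrow> real \<Rightarrow> nat \<Rightarrow> real \<Rightarrow> real" where
  "picard q y 0 t = y"
| "picard q y (Suc n) t = integral {0..t} (\<lambda>s. (if even n then 1 else - q s) * picard q y n s)"

declare picard.simps(2) [simp del]

context
  fixes q :: "real \<Rightarrow> real" and y M :: real
  assumes q_cont: "continuous_on {0..} q" and q_le: "\<And>t. 0 \<le> t \<Longrightarrow> \<bar>q t\<bar> \<le> M" and M1: "1 \<le> M"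
begin

lemma picard_derivative:
  assumes "t \<in> {0..T}"
  shows "(picard q y (Suc n) has_real_derivative (if even n then 1 else - q t) * picard q y n t)
          (at t within {0..T})"
  using assms
proof (induction n arbitrary: t)
  case 0
  have "((\<lambda>t. integral {0..t} (\<lambda>s. y)) has_real_derivative y) (at t within {0..T})"
    using 0 by (intro integral_has_real_derivative) auto
  then show ?case by (simp add: picard.simps(2))
next
  case (Suc n)
  have "continuous_on {0..T} (picard q y (Suc n))"
    unfolding continuous_on_eq_continuous_within using Suc.IH by (meson DERIV_continuous)
  moreover have "continuous_on {0..T} q"
    by (rule continuous_on_subset[OF q_cont]) auto
  ultimately have
    "continuous_on {0..T} (\<lambda>s. (if even (Suc n) then 1 else - q s) * picard q y (Suc n) s)"
    by (cases "even n") (auto intro!: continuous_intros)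
  from integral_has_real_derivative[OF this Suc.prems] show ?case
    by (subst picard.simps(2)[abs_def])
qed

text \<open>As \<open>M\<close> is at least 1, it dominates both multipliers 1 and
  \<open>- q\<close>, so each integration contributes the same factor as in the exponential series
  of \<open>M * t\<close>.\<close>

lemma picard_bound:
  assumes "0 \<le> t"
  shows "\<bar>picard q y n t\<bar> \<le> \<bar>y\<bar> * ((M * t) ^ n / fact n)"
  using assms
proof (induction n arbitrary: t)
  case (Suc n)
  define g where "g = (\<lambda>t. \<bar>y\<bar> * ((M * t) ^ Suc n / fact (Suc n)))"
  have g: "(g has_real_derivative M * (\<bar>y\<bar> * ((M * s) ^ n / fact n))) (at s within {0..t})" for s
  proof -
    have "g = (\<lambda>t. \<bar>y\<bar> * M ^ Suc n / fact (Suc n) * t ^ Suc n)"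
      by (simp add: g_def power_mult_distrib fun_eq_iff)
    moreover have "((\<lambda>t. C * t ^ Suc n) has_real_derivative C * (Suc n * s ^ n)) (at s within {0..t})" for C
      by (rule derivative_eq_intros refl)+ simp
    moreover have "\<bar>y\<bar> * M ^ Suc n / fact (Suc n) * (Suc n * s ^ n) = M * (\<bar>y\<bar> * ((M * s) ^ n / fact n))"
      by (simp add: fact_Suc power_mult_distrib del: of_nat_Suc)
    ultimately show ?thesis by metis
  qed
  have le: "\<bar>(if even n then 1 else - q s) * picard q y n s\<bar> \<le> M * (\<bar>y\<bar> * ((M * s) ^ n / fact n))"
    if "s \<in> {0..t}" for s
    unfolding abs_mult
    using that q_le[of s] M1 Suc.IH[of s] by (intro mult_mono) auto
  \<comment> \<open>Both \<open>g\<close> and the iterate vanish at 0, so monotonicity of their sum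
    and of their difference bounds the iterate from below and from above.\<close>
  have "g 0 + picard q y (Suc n) 0 \<le> g t + picard q y (Suc n) t"
  proof (rule has_real_derivative_nonneg_imp_le[OF Suc.prems DERIV_add[OF g picard_derivative]])
    show "0 \<le> M * (\<bar>y\<bar> * ((M * s) ^ n / fact n)) + (if even n then 1 else - q s) * picard q y n s"
      if "s \<in> {0..t}" for s
      using le[OF that] by linarith
  qed
  moreover have "g 0 - picard q y (Suc n) 0 \<le> g t - picard q y (Suc n) t"
  proof (rule has_real_derivative_nonneg_imp_le[OF Suc.prems DERIV_diff[OF g picard_derivative]])
    show "0 \<le> M * (\<bar>y\<bar> * ((M * s) ^ n / fact n)) - (if even n then 1 else - q s) * picard q y n s"
      if "s \<in> {0..t}" for s
      using le[OF that] by linarith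
  qed
  ultimately show ?case
    by (simp add: g_def abs_le_iff picard.simps(2))
qed simp

text \<open>The injection \<open>k\<close> selects the odd terms, the even ones, or the even ones
  without the first; each choice is dominated by a subseries of the exponential series.\<close>

lemma picard_uniform_limit:
  fixes k :: "nat \<Rightarrow> nat"
  assumes "inj k"
  shows "uniform_limit {0..T} (\<lambda>n t. \<Sum>i<n. picard q y (k i) t) (\<lambda>t. \<Sum>i. picard q y (k i) t) sequentially"
    and "t \<in> {0..T} \<Longrightarrow> summable (\<lambda>i. picard q y (k i) t)"
proof -
  have "summable ((\<lambda>n. \<bar>M * T\<bar> ^ n / fact n) \<circ> k)"
    using summable_exp_generic[of "\<bar>M * T\<bar>"] assms
    by (intro summable_reindex) (simp_all add: field_simps)
  then have s: "summable (\<lambda>i. \<bar>y\<bar> * (\<bar>M * T\<bar> ^ k i / fact (k i)))"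
    by (intro summable_mult) (simp add: comp_def)
  have le: "norm (picard q y (k i) t) \<le> \<bar>y\<bar> * (\<bar>M * T\<bar> ^ k i / fact (k i))" if "t \<in> {0..T}" for i t
  proof -
    have "(M * t) ^ k i \<le> \<bar>M * T\<bar> ^ k i"
      using that M1 by (intro power_mono) (auto simp: abs_mult)
    then have "\<bar>y\<bar> * ((M * t) ^ k i / fact (k i)) \<le> \<bar>y\<bar> * (\<bar>M * T\<bar> ^ k i / fact (k i))"
      by (intro mult_left_mono divide_right_mono) auto
    then show ?thesis
      using picard_bound[of t "k i"] that by simp
  qed
  show "uniform_limit {0..T} (\<lambda>n t. \<Sum>i<n. picard q y (k i) t) (\<lambda>t. \<Sum>i. picard q y (k i) t) sequentially"
    by (rule Weierstrass_m_test[OF le s])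
  show "t \<in> {0..T} \<Longrightarrow> summable (\<lambda>i. picard q y (k i) t)"
    by (rule summable_comparison_test'[OF s, of 0]) (rule le)
qed

lemma picard_solves_on:
  "solves_on {0..T} q (\<lambda>t. \<Sum>i. picard q y (Suc (2 * i)) t) (\<lambda>t. \<Sum>i. picard q y (2 * i) t)"
proof (cases "0 \<le> T")
  case True
  define u u' where "u = (\<lambda>t. \<Sum>i. picard q y (Suc (2 * i)) t)" and "u' = (\<lambda>t. \<Sum>i. picard q y (2 * i) t)"
  have inj: "inj (\<lambda>i::nat. Suc (2 * i))" "inj (\<lambda>i::nat. 2 * i)" "inj (\<lambda>i::nat. Suc (Suc (2 * i)))"
    by (auto simp: inj_on_def)
  have T: "T \<in> {0..T}" using True by simp
  note ul = picard_uniform_limit(1)[OF inj(1), of T] picard_uniform_limit(1)[OF inj(2), of T]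
  note sm = picard_uniform_limit(2)[OF inj(1)] picard_uniform_limit(2)[OF inj(2)]
    picard_uniform_limit(2)[OF inj(3)]
  have D: "(picard q y (Suc (2 * i)) has_real_derivative picard q y (2 * i) t) (at t within {0..T})"
    "(picard q y (Suc (Suc (2 * i))) has_real_derivative - q t * picard q y (Suc (2 * i)) t) (at t within {0..T})"
    if "t \<in> {0..T}" for i t
    using picard_derivative[OF that, of "2 * i"] picard_derivative[OF that, of "Suc (2 * i)"] by simp_all
  \<comment> \<open>Differentiating the odd terms gives the even ones, whose series converges
    uniformly by \<open>ul(2)\<close>.\<close>
  from has_field_derivative_series[OF convex_real_interval(5) D(1) ul(2) T sm(1)[OF T]]
  obtain g where g: "\<forall>t\<in>{0..T}. (\<lambda>i. picard q y (Suc (2 * i)) t) sums g t \<and>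
      (g has_real_derivative u' t) (at t within {0..T})" unfolding u'_def ..
  have gu: "u t = g t" if "t \<in> {0..T}" for t
    using bspec[OF g that] by (simp add: u_def sums_iff)
  \<comment> \<open>The even terms from the second on have as derivatives \<open>- q\<close> times
    the odd terms; boundedness of \<open>q\<close> and \<open>u\<close> on the interval lets the
    uniform limit pass through the product.\<close>
  have "uniform_limit {0..T} (\<lambda>n t. - q t * (\<Sum>i<n. picard q y (Suc (2 * i)) t)) (\<lambda>t. - q t * u t) sequentially"
  proof (rule uniform_lim_mult)
    show "bounded ((\<lambda>t. - q t) ` {0..T})"
      by (rule boundedI[where B = M]) (use q_le in auto)
    have "continuous_on {0..T} u"
      using DERIV_continuous g gu unfolding continuous_on_eq_continuous_within
      by (metis (no_types, lifting) continuous_on_cong continuous_on_eq_continuous_within)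
    then show "bounded (u ` {0..T})"
      by (intro compact_imp_bounded compact_continuous_image) auto
    show "uniform_limit {0..T} (\<lambda>n t. - q t) (\<lambda>t. - q t) sequentially"
      by (simp add: uniform_limit_iff)
    show "uniform_limit {0..T} (\<lambda>n t. \<Sum>i<n. picard q y (Suc (2 * i)) t) u sequentially"
      using ul(1) unfolding u_def .
  qed
  then have "uniform_limit {0..T} (\<lambda>n t. \<Sum>i<n. - q t * picard q y (Suc (2 * i)) t) (\<lambda>t. - q t * u t) sequentially"
    by (simp add: sum_distrib_left)
  from has_field_derivative_series[OF convex_real_interval(5) D(2) this T sm(3)[OF T]]
  obtain h where h: "\<forall>t\<in>{0..T}. (\<lambda>i. picard q y (Suc (Suc (2 * i))) t) sums h t \<and>
      (h has_real_derivative - q t * u t) (at t within {0..T})" ..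
  \<comment> \<open>The zeroth term \<open>y\<close> is not an integral of an earlier one, so it is
    split off; \<open>h\<close> sums the remaining even terms.\<close>
  have hu: "u' t = y + h t" if "t \<in> {0..T}" for t
    using suminf_split_head[OF sm(2)[OF that]] bspec[OF h that] by (simp add: u'_def sums_iff)
  have "(u has_real_derivative u' t) (at t within {0..T})" if "t \<in> {0..T}" for t
    by (rule has_real_derivative_transform_on[OF conjunct2[OF bspec[OF g that]] that]) (rule gu)
  moreover have "(u' has_real_derivative - (q t * u t)) (at t within {0..T})" if "t \<in> {0..T}" for t
  proof -
    have "((\<lambda>t. y + h t) has_real_derivative - (q t * u t)) (at t within {0..T})"
      using bspec[OF h that] by (auto intro!: derivative_eq_intros)
    then show ?thesis
      by (rule has_real_derivative_transform_on[OF _ that]) (rule hu)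
  qed
  ultimately show ?thesis
    by (simp add: solves_on_def u_def u'_def)
qed (simp add: solves_on_def)

end

text \<open>Near \<open>t\<close> the half-line and \<open>{0..t + 1}\<close> coincide. The Picard
  series is the same for every \<open>T\<close>, so it passes to the half-line without
  gluing.\<close>

lemma solves_on_atLeastI:
  assumes "\<And>T. solves_on {0..T} q u u'"
  shows "solves_on {0..} q u u'"
proof -
  have "at t within {0..t + 1} = at t within {0..}" for t :: real
    by (rule at_within_nhd[of _ "{..<t + 1}"]) auto
  moreover have "solves_on {0..t + 1} q u u'" for t
    by (rule assms)
  ultimately show ?thesis
    unfolding solves_on_def by (metis atLeastAtMost_iff atLeast_iff less_add_one less_imp_le)
qed

lemma solution_exists:
  assumes "continuous_on {0..} q" and "\<And>t. 0 \<le> t \<Longrightarrow> \<bar>q t\<bar> \<le> M"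
  shows "\<exists>u u'. solves_on {0..} q u u' \<and> u 0 = 0 \<and> u' 0 = y"
proof (intro exI conjI)
  have *: "\<bar>q t\<bar> \<le> max 1 M" if "0 \<le> t" for t
    using assms(2)[OF that] by simp
  show "solves_on {0..} q (\<lambda>t. \<Sum>i. picard q y (Suc (2 * i)) t) (\<lambda>t. \<Sum>i. picard q y (2 * i) t)"
    by (rule solves_on_atLeastI, rule picard_solves_on[OF assms(1) *]) auto
  show "(\<Sum>i. picard q y (Suc (2 * i)) 0) = 0"
    by (simp add: picard.simps(2))
  have "picard q y (2 * i) 0 = (if i = 0 then y else 0)" for i
    by (cases i) (simp_all add: picard.simps(2))
  then show "(\<Sum>i. picard q y (2 * i) 0) = y"
    by (simp add: sums_unique[OF sums_single, symmetric])
qed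

section \<open>Closedness of the exceptional sets\<close>

lemma coefficients_bounds:
  assumes "c \<in> coefficients \<mu>\<^sub>1 \<mu>\<^sub>2 H \<alpha>" "0 \<le> t"
  shows "\<mu>\<^sub>1 \<le> c t" "c t \<le> \<mu>\<^sub>2"
  using assms unfolding coefficients_def by (auto simp: PiE_iff)

lemma coefficients_continuous_on:
  assumes c: "c \<in> coefficients \<mu>\<^sub>1 \<mu>\<^sub>2 H \<alpha>" and "0 < \<alpha>"
  shows "continuous_on {0..} c"
  unfolding continuous_on_def
proof
  fix t :: real assume t: "t \<in> {0..}"
  have "((\<lambda>s. H * \<bar>s - t\<bar> powr \<alpha>) \<longlongrightarrow> H * \<bar>t - t\<bar> powr \<alpha>) (at t within {0..})"
    by (intro tendsto_intros tendsto_powr') (use \<open>0 < \<alpha>\<close> in auto)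
  then have "((\<lambda>s. H * \<bar>s - t\<bar> powr \<alpha>) \<longlongrightarrow> 0) (at t within {0..})"
    by simp
  moreover have "\<forall>\<^sub>F s in at t within {0..}. norm (c s - c t) \<le> H * \<bar>s - t\<bar> powr \<alpha>"
    using c t by (auto simp: eventually_at_filter coefficients_def)
  ultimately have "((\<lambda>s. c s - c t) \<longlongrightarrow> 0) (at t within {0..})"
    by (rule Lim_null_comparison[rotated])
  then show "(c \<longlongrightarrow> c t) (at t within {0..})"
    by (simp add: LIM_zero_iff)
qed

text \<open>The equation expresses the second derivative through \<open>c\<close> and
  \<open>u\<close>, so its continuity follows from theirs.\<close>

lemma very_weak_solution_iff:
  assumes "continuous_on {0..} c"
  shows "very_weak_solution lam c u\<^sub>0 u\<^sub>1 u u' \<longleftrightarrow>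
    (\<forall>i. u 0 i = u\<^sub>0 i \<and> u' 0 i = u\<^sub>1 i \<and>
      solves_on {0..} (\<lambda>t. (lam i)\<^sup>2 * c t) (\<lambda>t. u t i) (\<lambda>t. u' t i))" (is "?L \<longleftrightarrow> ?R")
proof
  assume ?L
  show ?R
  proof (intro allI conjI)
    fix i
    show "u 0 i = u\<^sub>0 i" "u' 0 i = u\<^sub>1 i"
      using \<open>?L\<close> by (auto simp: very_weak_solution_def)
    obtain u'' where u'': "\<forall>t\<ge>0. ((\<lambda>r. u r i) has_real_derivative u' t i) (at t within {0..}) \<and>
                ((\<lambda>r. u' r i) has_real_derivative u'' t) (at t within {0..}) \<and>
                u'' t + c t * (lam i)\<^sup>2 * u t i = 0"
      using \<open>?L\<close> unfolding very_weak_solution_def by blast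
    moreover have "u'' t = - ((lam i)\<^sup>2 * c t * u t i)" if "0 \<le> t" for t
      using u'' that by (simp add: add_eq_0_iff mult.commute)
    ultimately show "solves_on {0..} (\<lambda>t. (lam i)\<^sup>2 * c t) (\<lambda>t. u t i) (\<lambda>t. u' t i)"
      by (simp add: solves_on_def)
  qed
next
  assume R: ?R
  show ?L
    unfolding very_weak_solution_def
  proof (intro allI conjI)
    fix i
    show "u 0 i = u\<^sub>0 i" "u' 0 i = u\<^sub>1 i"
      using R by auto
    have s: "solves_on {0..} (\<lambda>t. (lam i)\<^sup>2 * c t) (\<lambda>t. u t i) (\<lambda>t. u' t i)"
      using R by blast
    have "continuous_on {0..} (\<lambda>t. - ((lam i)\<^sup>2 * c t * u t i))"
      by (intro continuous_intros assms solves_on_continuous(1)[OF s])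
    with s show "\<exists>u''. continuous_on {0..} u'' \<and>
         (\<forall>t\<ge>0. ((\<lambda>r. u r i) has_real_derivative u' t i) (at t within {0..}) \<and>
                ((\<lambda>r. u' r i) has_real_derivative u'' t) (at t within {0..}) \<and>
                u'' t + c t * (lam i)\<^sup>2 * u t i = 0)"
      by (intro exI[of _ "\<lambda>t. - ((lam i)\<^sup>2 * c t * u t i)"]) (auto simp: solves_on_def algebra_simps)
  qed
qed

lemma coefficients_mult_bound:
  assumes "c \<in> coefficients \<mu>\<^sub>1 \<mu>\<^sub>2 H \<alpha>" "0 < \<mu>\<^sub>1" "0 \<le> t"
  shows "\<bar>l\<^sup>2 * c t\<bar> \<le> l\<^sup>2 * \<mu>\<^sub>2"
  using coefficients_bounds[OF assms(1,3)] assms(2) by (simp add: abs_mult mult_left_mono)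

lemma very_weak_solution_exists:
  assumes c: "c \<in> coefficients \<mu>\<^sub>1 \<mu>\<^sub>2 H \<alpha>" and "0 < \<alpha>" "0 < \<mu>\<^sub>1"
  shows "\<exists>u u'. very_weak_solution lam c (\<lambda>i. 0) \<psi> u u'"
proof -
  note cont = coefficients_continuous_on[OF c \<open>0 < \<alpha>\<close>]
  have "\<forall>i. \<exists>v v'. solves_on {0..} (\<lambda>t. (lam i)\<^sup>2 * c t) v v' \<and> v 0 = 0 \<and> v' 0 = \<psi> i"
  proof
    fix i
    show "\<exists>v v'. solves_on {0..} (\<lambda>t. (lam i)\<^sup>2 * c t) v v' \<and> v 0 = 0 \<and> v' 0 = \<psi> i"
      by (rule solution_exists[OF _ coefficients_mult_bound[OF c \<open>0 < \<mu>\<^sub>1\<close>]])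
        (intro continuous_intros cont)
  qed
  then obtain v v' where "\<forall>i. solves_on {0..} (\<lambda>t. (lam i)\<^sup>2 * c t) (v i) (v' i) \<and> v i 0 = 0 \<and> v' i 0 = \<psi> i"
    by metis
  then have "very_weak_solution lam c (\<lambda>i. 0) \<psi> (\<lambda>t i. v i t) (\<lambda>t i. v' i t)"
    by (simp add: very_weak_solution_iff[OF cont])
  then show ?thesis by blast
qed

text \<open>Mode-by-mode bounds replace summability because they survive limits of single modes. One
  parameter \<open>k\<close> controls size, exponential rate and time window, so that countably many
  sets exhaust the exceptional pairs. The window avoids 0, where the data themselves are
  tame.\<close>

definition tame_set ::
    "((real \<Rightarrow> real) \<times> (nat \<Rightarrow> real)) set \<Rightarrow> (nat \<Rightarrow> real) \<Rightarrow> real \<Rightarrow> real \<Rightarrow>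
     ((real \<Rightarrow> real) \<times> (nat \<Rightarrow> real)) set" where
  "tame_set X lam B k =
     {(c, \<psi>) \<in> X. \<exists>u u'. very_weak_solution lam c (\<lambda>i. 0) \<psi> u u' \<and>
        (\<exists>t\<in>{1 / k..k}. \<forall>i. (u t i)\<^sup>2 + (u' t i)\<^sup>2 \<le> k * exp (2 * k * lam i powr (1 / B)))}"

text \<open>The terms of a convergent series are bounded, which turns summability into a pointwise
  bound; \<open>k\<close> is then taken above \<open>t\<close>, \<open>1 / t\<close>,
  \<open>R\<close> and the sum of the two constants.\<close>

lemma tame_setI:
  assumes "(c, \<psi>) \<in> X" "very_weak_solution lam c (\<lambda>i. 0) \<psi> u u'" "0 < t" "0 < R"
    and "u t \<in> gevrey_ultradistributions lam B R" "u' t \<in> gevrey_ultradistributions lam B R"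
  shows "\<exists>n. (c, \<psi>) \<in> tame_set X lam B (real (Suc n))"
proof -
  have "\<exists>K. \<forall>i. (v i)\<^sup>2 \<le> K * exp (2 * R * lam i powr (1 / B))"
    if "v \<in> gevrey_ultradistributions lam B R" for v
  proof -
    have "Bseq (\<lambda>i. (v i)\<^sup>2 * exp (- 2 * R * lam i powr (1 / B)))"
      using that unfolding gevrey_ultradistributions_def
      by (intro convergent_imp_Bseq) (auto dest: summable_LIMSEQ_zero simp: convergent_def)
    then obtain K where K: "\<And>i. (v i)\<^sup>2 * exp (- 2 * R * lam i powr (1 / B)) \<le> K"
      unfolding Bseq_def by fastforce
    have "(v i)\<^sup>2 \<le> K * exp (2 * R * lam i powr (1 / B))" for i
      using mult_right_mono[OF K[of i], of "exp (2 * R * lam i powr (1 / B))"]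
      by (simp add: mult.assoc flip: exp_add)
    then show ?thesis by blast
  qed
  from this[OF assms(5)] this[OF assms(6)] obtain K K' where
    K: "\<And>i. (u t i)\<^sup>2 \<le> K * exp (2 * R * lam i powr (1 / B))"
      "\<And>i. (u' t i)\<^sup>2 \<le> K' * exp (2 * R * lam i powr (1 / B))"
    by blast
  obtain n where n: "max (max t (1 / t)) (max R (K + K')) \<le> real n"
    using real_arch_simple by blast
  define k where "k = real (Suc n)"
  have k: "t \<le> k" "1 / t \<le> k" "R \<le> k" "K + K' \<le> k" "0 < k"
    using n by (auto simp: k_def)
  have "(u t i)\<^sup>2 + (u' t i)\<^sup>2 \<le> k * exp (2 * k * lam i powr (1 / B))" for i
  proof -
    have "(u t i)\<^sup>2 + (u' t i)\<^sup>2 \<le> (K + K') * exp (2 * R * lam i powr (1 / B))"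
      using K[of i] by (simp add: distrib_right)
    also have "\<dots> \<le> k * exp (2 * R * lam i powr (1 / B))"
      using k by (intro mult_right_mono) auto
    also have "\<dots> \<le> k * exp (2 * k * lam i powr (1 / B))"
      using k by (intro mult_left_mono) (auto intro!: mult_right_mono)
    finally show ?thesis .
  qed
  moreover have "t \<in> {1 / k..k}"
    using k \<open>0 < t\<close> by (simp add: field_simps)
  ultimately have "(c, \<psi>) \<in> tame_set X lam B k"
    using assms(1,2) unfolding tame_set_def by blast
  then show ?thesis
    unfolding k_def by blast
qed

text \<open>The times at which the pairs of a convergent sequence are tame vary, so a subsequence of
  them converging in \<open>{1 / k..k}\<close> is chosen. Each mode converges uniformly on that
  window, hence also along the moving times; the estimates may depend on the mode
  \<open>i\<close>.\<close>

lemma closedin_tame_set: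
  fixes \<mu>\<^sub>1 \<mu>\<^sub>2 H \<alpha> \<beta> B k :: real and lam :: "nat \<Rightarrow> real"
  assumes "0 < \<alpha>" "0 < \<mu>\<^sub>1" "0 < k"
  defines "X \<equiv> X_space \<mu>\<^sub>1 \<mu>\<^sub>2 H \<alpha> lam \<beta>" and "d \<equiv> X_dist \<mu>\<^sub>1 \<mu>\<^sub>2 H \<alpha> lam \<beta>"
  shows "closedin (Metric_space.mtopology X d) (tame_set X lam B k)"
proof -
  interpret X: Metric_space X d
    unfolding X_def d_def by (rule Metric_space_X)
  have "p \<in> tame_set X lam B k"
    if \<sigma>: "range \<sigma> \<subseteq> tame_set X lam B k" and lim: "limitin X.mtopology \<sigma> p sequentially" for \<sigma> p
  proof -
    obtain c \<psi> where p: "p = (c, \<psi>)" by fastforce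
    define cn \<psi>n where "cn = (\<lambda>n. fst (\<sigma> n))" and "\<psi>n = (\<lambda>n. snd (\<sigma> n))"
    have \<sigma>n: "\<sigma> n = (cn n, \<psi>n n)" for n by (simp add: cn_def \<psi>n_def)
    have \<sigma>X: "(cn n, \<psi>n n) \<in> X" for n
    proof -
      have "\<sigma> n \<in> tame_set X lam B k"
        using \<sigma> by blast
      then show ?thesis
        by (auto simp: tame_set_def \<sigma>n)
    qed
    have pX: "(c, \<psi>) \<in> X"
      using lim p by (simp add: X.limit_metric_sequentially)
    have c: "c \<in> coefficients \<mu>\<^sub>1 \<mu>\<^sub>2 H \<alpha>" "\<And>n. cn n \<in> coefficients \<mu>\<^sub>1 \<mu>\<^sub>2 H \<alpha>"
      and \<psi>: "\<psi> \<in> gevrey_inf lam \<beta>" "\<And>n. \<psi>n n \<in> gevrey_inf lam \<beta>"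
      using pX \<sigma>X by (auto simp: X_def X_space_def)
    have d0: "(\<lambda>n. d (\<sigma> n) p) \<longlonglongrightarrow> 0"
      using X.limitin_metric_dist_null lim by blast
    have d: "d (\<sigma> n) p = coefficients_dist (cn n) c + gevrey_inf_norm lam \<beta> (\<lambda>i. \<psi>n n i - \<psi> i)" for n
      using pX \<sigma>X[of n] unfolding p \<sigma>n by (simp add: d_def X_def X_dist_def)
    have le: "coefficients_dist (cn n) c \<le> d (\<sigma> n) p"
      "gevrey_inf_norm lam \<beta> (\<lambda>i. \<psi>n n i - \<psi> i) \<le> d (\<sigma> n) p" for n
      using coefficients_dist_nonneg[OF c(2) c(1), of n]
        gevrey_inf_norm_nonneg[OF gevrey_inf_diff[OF \<psi>(2) \<psi>(1)], of n]
      by (simp_all add: d)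
    have "\<forall>n. \<exists>u u' t. very_weak_solution lam (cn n) (\<lambda>i. 0) (\<psi>n n) u u' \<and> t \<in> {1 / k..k} \<and>
        (\<forall>i. (u t i)\<^sup>2 + (u' t i)\<^sup>2 \<le> k * exp (2 * k * lam i powr (1 / B)))"
    proof
      fix n
      have "(cn n, \<psi>n n) \<in> tame_set X lam B k"
        using \<sigma> by (metis \<sigma>n rangeI subsetD)
      then show "\<exists>u u' t. very_weak_solution lam (cn n) (\<lambda>i. 0) (\<psi>n n) u u' \<and> t \<in> {1 / k..k} \<and>
        (\<forall>i. (u t i)\<^sup>2 + (u' t i)\<^sup>2 \<le> k * exp (2 * k * lam i powr (1 / B)))"
        unfolding tame_set_def by blast
    qed
    then obtain un un' tn where
      un: "\<And>n. very_weak_solution lam (cn n) (\<lambda>i. 0) (\<psi>n n) (un n) (un' n)"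
      and tn: "\<And>n. tn n \<in> {1 / k..k}"
      and bd: "\<And>n i. (un n (tn n) i)\<^sup>2 + (un' n (tn n) i)\<^sup>2 \<le> k * exp (2 * k * lam i powr (1 / B))"
      by metis
    obtain u u' where u: "very_weak_solution lam c (\<lambda>i. 0) \<psi> u u'"
      using very_weak_solution_exists[OF c(1) \<open>0 < \<alpha>\<close> \<open>0 < \<mu>\<^sub>1\<close>] by blast
    obtain t r where t: "t \<in> {1 / k..k}" and r: "strict_mono r" and tr: "(tn \<circ> r) \<longlonglongrightarrow> t"
      using compact_Icc[of "1 / k" k] tn unfolding compact_eq_seq_compact_metric seq_compact_def
      by metis
    have "(u t i)\<^sup>2 + (u' t i)\<^sup>2 \<le> k * exp (2 * k * lam i powr (1 / B))" for i
    proof -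
      define l where "l = lam i"
      have sol: "solves_on {0..} (\<lambda>t. l\<^sup>2 * c t) (\<lambda>t. u t i) (\<lambda>t. u' t i)"
        "u 0 i = 0" "u' 0 i = \<psi> i"
        using u unfolding very_weak_solution_iff[OF coefficients_continuous_on[OF c(1) \<open>0 < \<alpha>\<close>]] l_def
        by auto
      have soln: "solves_on {0..} (\<lambda>t. l\<^sup>2 * cn n t) (\<lambda>t. un n t i) (\<lambda>t. un' n t i)"
        "un n 0 i = 0" "un' n 0 i = \<psi>n n i" for n
        using un[of n] unfolding very_weak_solution_iff[OF coefficients_continuous_on[OF c(2) \<open>0 < \<alpha>\<close>]] l_def
        by auto
      have "bounded ((\<lambda>t. u t i) ` {0..k})"
        by (intro compact_imp_bounded compact_continuous_image
            continuous_on_subset[OF solves_on_continuous(1)[OF sol(1)]]) auto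
      then obtain V where V: "\<And>s. s \<in> {0..k} \<Longrightarrow> \<bar>u s i\<bar> \<le> V"
        unfolding bounded_iff by fastforce
      define w where "w = sqrt (exp (l powr (1 / \<beta>) * ln (1 + l)))"
      \<comment> \<open>\<open>1 / w\<^sup>2\<close> is the cost of reading one component off the
        weighted norm, the second summand comes from a coefficient error
        \<open>l\<^sup>2 * D\<close> acting on the limit solution, and the exponent is that of
        \<open>solution_difference\<close>. All of it is independent of \<open>n\<close>.\<close>
      define C where "C = (1 / w\<^sup>2 + (l\<^sup>2)\<^sup>2 * V\<^sup>2 * k) * exp ((2 + l\<^sup>2 * \<mu>\<^sub>2) * k)"
      have w: "0 < w" by (simp add: w_def)
      have est: "(un n (tn n) i - u (tn n) i)\<^sup>2 + (un' n (tn n) i - u' (tn n) i)\<^sup>2 \<le> C * (d (\<sigma> n) p)\<^sup>2"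
        for n
      proof -
        define D where "D = d (\<sigma> n) p"
        have D: "0 \<le> D" unfolding D_def by simp
        have tnn: "0 \<le> tn n" "tn n \<le> k" using tn[of n] \<open>0 < k\<close> by (auto intro: order_trans[rotated])
        have \<mu>: "0 \<le> \<mu>\<^sub>2" using coefficients_bounds[OF c(1), of 0] \<open>0 < \<mu>\<^sub>1\<close> by auto
        have "(un n (tn n) i - u (tn n) i)\<^sup>2 + (un' n (tn n) i - u' (tn n) i)\<^sup>2 \<le>
          ((un n 0 i - u 0 i)\<^sup>2 + (un' n 0 i - u' 0 i)\<^sup>2 + (l\<^sup>2 * D)\<^sup>2 * V\<^sup>2 * tn n)
            * exp ((2 + l\<^sup>2 * \<mu>\<^sub>2) * tn n)"
        proof (rule solution_difference[where q = "\<lambda>t. l\<^sup>2 * cn n t" and r = "\<lambda>t. l\<^sup>2 * c t"])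
          fix s assume s: "s \<in> {0..tn n}"
          show "\<bar>l\<^sup>2 * cn n s\<bar> \<le> l\<^sup>2 * \<mu>\<^sub>2"
            using coefficients_mult_bound[OF c(2) \<open>0 < \<mu>\<^sub>1\<close>] s by auto
          have "\<bar>cn n s - c s\<bar> \<le> D"
            using coefficients_dist_upper[OF c(2) c(1), of s n] le(1)[of n] s by (simp add: D_def)
          then show "\<bar>l\<^sup>2 * cn n s - l\<^sup>2 * c s\<bar> \<le> l\<^sup>2 * D"
            by (simp add: abs_mult mult_left_mono flip: right_diff_distrib)
          show "\<bar>u s i\<bar> \<le> V" using V s tnn by auto
        qed (use tnn in \<open>auto intro: solves_on_subset[OF sol(1)] solves_on_subset[OF soln(1)]\<close>)
        also have "\<dots> = ((\<psi>n n i - \<psi> i)\<^sup>2 + (l\<^sup>2 * D)\<^sup>2 * V\<^sup>2 * tn n) * exp ((2 + l\<^sup>2 * \<mu>\<^sub>2) * tn n)"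
          using sol soln by simp
        also have "\<dots> \<le> (D\<^sup>2 / w\<^sup>2 + (l\<^sup>2 * D)\<^sup>2 * V\<^sup>2 * k) * exp ((2 + l\<^sup>2 * \<mu>\<^sub>2) * k)"
        proof (intro mult_mono add_mono)
          have "\<bar>\<psi>n n i - \<psi> i\<bar> * w \<le> D"
            using gevrey_inf_coordinate_le[OF gevrey_inf_diff[OF \<psi>(2)[of n] \<psi>(1)], of i] le(2)[of n]
            by (simp add: w_def l_def D_def)
          then have "\<bar>\<psi>n n i - \<psi> i\<bar> \<le> D / w"
            using w by (simp add: pos_le_divide_eq)
          then have "\<bar>\<psi>n n i - \<psi> i\<bar>\<^sup>2 \<le> (D / w)\<^sup>2"
            by (intro power_mono) auto
          then show "(\<psi>n n i - \<psi> i)\<^sup>2 \<le> D\<^sup>2 / w\<^sup>2"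
            by (simp add: power_divide)
          show "exp ((2 + l\<^sup>2 * \<mu>\<^sub>2) * tn n) \<le> exp ((2 + l\<^sup>2 * \<mu>\<^sub>2) * k)"
            using tnn \<mu> by (auto intro!: mult_left_mono)
        qed (use tnn in auto)
        also have "\<dots> = C * D\<^sup>2"
          by (simp add: C_def field_simps power_mult_distrib)
        finally show ?thesis by (simp add: D_def)
      qed
      have lim0: "(\<lambda>n. C * (d (\<sigma> n) p)\<^sup>2) \<longlonglongrightarrow> 0"
        using tendsto_mult_left[OF tendsto_power[OF d0, of 2], of C] by simp
      have conv: "(\<lambda>n. f n (tn n) - g (tn n)) \<longlonglongrightarrow> 0"
        if "\<And>n. (f n (tn n) - g (tn n))\<^sup>2 \<le> C * (d (\<sigma> n) p)\<^sup>2" for f :: "nat \<Rightarrow> real \<Rightarrow> real" and g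
      proof -
        have "(\<lambda>n. (f n (tn n) - g (tn n))\<^sup>2) \<longlonglongrightarrow> 0"
          by (rule tendsto_sandwich[OF _ _ tendsto_const lim0]) (use that in auto)
        then show ?thesis by (simp add: power_tendsto_0_iff)
      qed
      have "0 \<le> s" if "s \<in> {1 / k..k}" for s
        using that \<open>0 < k\<close> by (auto intro: order_trans[rotated])
      then have t0: "t \<in> {0..}" "\<And>n. (tn \<circ> r) n \<in> {0..}"
        using t tn by auto
      \<comment> \<open>The difference at time \<open>tn n\<close> tends to 0 by the uniform
        estimate, and continuity of the limit solution handles \<open>g (tn (r n))\<close>.\<close>
      have conv': "(\<lambda>n. f (r n) (tn (r n))) \<longlonglongrightarrow> g t"
        if "\<And>n. (f n (tn n) - g (tn n))\<^sup>2 \<le> C * (d (\<sigma> n) p)\<^sup>2" "continuous_on {0..} g"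
        for f :: "nat \<Rightarrow> real \<Rightarrow> real" and g
      proof -
        have "(\<lambda>n. g (tn (r n))) \<longlonglongrightarrow> g t"
          using continuous_on_tendsto_compose[OF that(2) tr t0(1)] t0(2) by simp
        from tendsto_add[OF LIMSEQ_subseq_LIMSEQ[OF conv[of f g, OF that(1)] r] this] show ?thesis
          by (simp add: comp_def)
      qed
      have e1: "(un n (tn n) i - u (tn n) i)\<^sup>2 \<le> C * (d (\<sigma> n) p)\<^sup>2" for n
        using est[of n] zero_le_power2[of "un' n (tn n) i - u' (tn n) i"] by linarith
      have e2: "(un' n (tn n) i - u' (tn n) i)\<^sup>2 \<le> C * (d (\<sigma> n) p)\<^sup>2" for n
        using est[of n] zero_le_power2[of "un n (tn n) i - u (tn n) i"] by linarith
      have "(\<lambda>n. un (r n) (tn (r n)) i) \<longlonglongrightarrow> u t i" "(\<lambda>n. un' (r n) (tn (r n)) i) \<longlonglongrightarrow> u' t i"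
        using conv'[of "\<lambda>n s. un n s i" "\<lambda>s. u s i", OF e1 solves_on_continuous(1)[OF sol(1)]]
          conv'[of "\<lambda>n s. un' n s i" "\<lambda>s. u' s i", OF e2 solves_on_continuous(2)[OF sol(1)]] by auto
      then have "(\<lambda>n. (un (r n) (tn (r n)) i)\<^sup>2 + (un' (r n) (tn (r n)) i)\<^sup>2) \<longlonglongrightarrow> (u t i)\<^sup>2 + (u' t i)\<^sup>2"
        by (intro tendsto_intros)
      then show ?thesis
        by (rule LIMSEQ_le_const2) (use bd in blast)
    qed
    then show ?thesis
      using pX u t unfolding p tame_set_def by blast
  qed
  moreover have "tame_set X lam B k \<subseteq> X"
    by (auto simp: tame_set_def)
  ultimately show ?thesis
    unfolding X.metric_closedin_iff_sequentially_closed by blast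
qed

section \<open>Resonance\<close>

text \<open>The coefficient is found by requiring that \<open>sin (\<omega> t) exp (\<eta> t)\<close> with
  \<open>\<eta>' = a sin\<^sup>2 (\<omega> t)\<close> be a solution: all terms of its second derivative then contain the factor
  \<open>sin (\<omega> t)\<close>.\<close>

lemma resonant_solution:
  fixes a \<omega> :: real
  assumes "0 < \<omega>"
  defines "\<eta> \<equiv> \<lambda>t. a * (t / 2 - sin (\<omega> * t) * cos (\<omega> * t) / (2 * \<omega>))"
  shows "solves_on S (\<lambda>t. \<omega>\<^sup>2 - (4 * a * \<omega> * sin (\<omega> * t) * cos (\<omega> * t) + a\<^sup>2 * sin (\<omega> * t) ^ 4))
    (\<lambda>t. C * sin (\<omega> * t) * exp (\<eta> t))
    (\<lambda>t. C * (\<omega> * cos (\<omega> * t) + a * sin (\<omega> * t) ^ 3) * exp (\<eta> t))"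
proof -
  have \<eta>: "(\<eta> has_real_derivative a * (sin (\<omega> * t))\<^sup>2) (at t within S)" for t
  proof -
    have \<eta>: "\<eta> = (\<lambda>t. a * (1 / 2 * t - 1 / (2 * \<omega>) * (sin (\<omega> * t) * cos (\<omega> * t))))"
      by (simp add: \<eta>_def)
    have "(\<eta> has_real_derivative a * (1 / 2 - (cos (\<omega> * t) * cos (\<omega> * t) - sin (\<omega> * t) * sin (\<omega> * t)) / 2))
        (at t within S)"
      unfolding \<eta> by (rule derivative_eq_intros refl)+ (use \<open>0 < \<omega>\<close> in \<open>simp_all add: field_simps\<close>)
    moreover have "cos (\<omega> * t) * cos (\<omega> * t) = 1 - (sin (\<omega> * t))\<^sup>2"
      using sin_cos_squared_add[of "\<omega> * t"] by (simp add: power2_eq_square)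
    ultimately show ?thesis
      by (simp add: power2_eq_square diff_divide_distrib)
  qed
  have "((\<lambda>t. C * sin (\<omega> * t) * exp (\<eta> t)) has_real_derivative
    C * (\<omega> * cos (\<omega> * t) + a * sin (\<omega> * t) ^ 3) * exp (\<eta> t)) (at t within S)" for t
    by (rule derivative_eq_intros \<eta> refl)+ (simp add: algebra_simps power2_eq_square power3_eq_cube)
  moreover have "((\<lambda>t. C * (\<omega> * cos (\<omega> * t) + a * sin (\<omega> * t) ^ 3) * exp (\<eta> t)) has_real_derivative
    - ((\<omega>\<^sup>2 - (4 * a * \<omega> * sin (\<omega> * t) * cos (\<omega> * t) + a\<^sup>2 * sin (\<omega> * t) ^ 4))
        * (C * sin (\<omega> * t) * exp (\<eta> t)))) (at t within S)" for t
    by (rule derivative_eq_intros \<eta> refl)+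
      (simp add: algebra_simps power2_eq_square power3_eq_cube power4_eq_xxxx)
  ultimately show ?thesis
    by (simp add: solves_on_def)
qed

text \<open>Up to \<open>x = 1\<close> the Lipschitz bound is the useful one, beyond it the sup
  bound. With \<open>x = \<omega> * \<bar>t - s\<bar>\<close> the oscillation pays
  \<open>\<omega> powr \<alpha>\<close> instead of \<open>\<omega>\<close>.\<close>

lemma lipschitz_bounded_imp_holder:
  fixes f :: "real \<Rightarrow> real"
  assumes "\<bar>f t\<bar> \<le> M" "\<bar>f s\<bar> \<le> M" and "\<bar>f t - f s\<bar> \<le> M * x" and "0 < \<alpha>" "\<alpha> \<le> 1" "0 \<le> x"
  shows "\<bar>f t - f s\<bar> \<le> 2 * M * x powr \<alpha>"
proof -
  have "0 \<le> M" using assms(1) by simp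
  show ?thesis
  proof (cases "x \<le> 1")
    case True
    have "x \<le> x powr \<alpha>"
      using powr_mono'[of \<alpha> 1 x] assms True by simp
    then have "M * x \<le> M * x powr \<alpha>" "0 \<le> M * x powr \<alpha>"
      using \<open>0 \<le> M\<close> by (auto intro: mult_left_mono)
    then show ?thesis using assms(3) by linarith
  next
    case False
    then have "2 * M * 1 \<le> 2 * M * x powr \<alpha>"
      using \<open>0 \<le> M\<close> \<open>0 < \<alpha>\<close> by (intro mult_left_mono ge_one_powr_ge_zero) auto
    then show ?thesis using assms(1,2) by linarith
  qed
qed

text \<open>As functions of the phase \<open>\<omega> * t\<close>, the term and its derivative share
  one bound, as \<open>lipschitz_bounded_imp_holder\<close> asks; the 4 before
  \<open>a\<^sup>2\<close> stems from differentiating the fourth power.\<close>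

lemma resonant_term_bounds:
  fixes a \<omega> t s :: real
  assumes "0 \<le> a" "0 \<le> \<omega>"
  defines "f \<equiv> \<lambda>t. 4 * a * \<omega> * sin (\<omega> * t) * cos (\<omega> * t) + a\<^sup>2 * sin (\<omega> * t) ^ 4"
  shows "\<bar>f t\<bar> \<le> 4 * a * \<omega> + 4 * a\<^sup>2"
    and "\<bar>f t - f s\<bar> \<le> (4 * a * \<omega> + 4 * a\<^sup>2) * (\<omega> * \<bar>t - s\<bar>)"
proof -
  define g where "g = (\<lambda>x::real. 4 * a * \<omega> * (sin x * cos x) + a\<^sup>2 * sin x ^ 4)"
  have fg: "f t = g (\<omega> * t)" for t by (simp add: f_def g_def mult.assoc)
  have sc: "\<bar>sin x * cos x\<bar> \<le> 1" for x :: real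
    unfolding abs_mult by (intro mult_le_one) auto
  have s4: "\<bar>sin x ^ n\<bar> \<le> 1" for x :: real and n
    unfolding power_abs by (rule power_le_one) auto
  have ub: "\<bar>4 * a * \<omega> * y + a\<^sup>2 * z\<bar> \<le> 4 * a * \<omega> + 4 * a\<^sup>2" if "\<bar>y\<bar> \<le> 1" "\<bar>z\<bar> \<le> 4" for y z
  proof -
    have "\<bar>4 * a * \<omega> * y + a\<^sup>2 * z\<bar> \<le> \<bar>4 * a * \<omega> * y\<bar> + \<bar>a\<^sup>2 * z\<bar>"
      by (rule abs_triangle_ineq)
    also have "\<dots> = 4 * a * \<omega> * \<bar>y\<bar> + a\<^sup>2 * \<bar>z\<bar>"
      using assms(1,2) by (simp add: abs_mult)
    also have "\<dots> \<le> 4 * a * \<omega> * 1 + a\<^sup>2 * 4"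
      using that assms(1,2) by (intro add_mono mult_left_mono) auto
    finally show ?thesis by simp
  qed
  show "\<bar>f t\<bar> \<le> 4 * a * \<omega> + 4 * a\<^sup>2"
    unfolding fg g_def by (intro ub sc order_trans[OF s4]) simp
  have "norm (g (\<omega> * t) - g (\<omega> * s)) \<le> (4 * a * \<omega> + 4 * a\<^sup>2) * norm (\<omega> * t - \<omega> * s)"
  proof (rule field_differentiable_bound[of UNIV])
    fix x :: real
    show "(g has_field_derivative 4 * a * \<omega> * ((cos x)\<^sup>2 - (sin x)\<^sup>2) + a\<^sup>2 * (4 * (sin x ^ 3 * cos x))) (at x within UNIV)"
      unfolding g_def
      by (rule derivative_eq_intros refl)+ (simp add: algebra_simps power2_eq_square)
    have "\<bar>sin x ^ 3 * cos x\<bar> \<le> 1"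
      unfolding abs_mult by (intro mult_le_one s4) auto
    moreover have "\<bar>(cos x)\<^sup>2 - (sin x)\<^sup>2\<bar> \<le> 1"
      by (simp flip: cos_double)
    ultimately show "norm (4 * a * \<omega> * ((cos x)\<^sup>2 - (sin x)\<^sup>2) + a\<^sup>2 * (4 * (sin x ^ 3 * cos x))) \<le> 4 * a * \<omega> + 4 * a\<^sup>2"
      unfolding real_norm_def by (intro ub) auto
  qed auto
  then show "\<bar>f t - f s\<bar> \<le> (4 * a * \<omega> + 4 * a\<^sup>2) * (\<omega> * \<bar>t - s\<bar>)"
    using assms(2) unfolding fg by (simp add: abs_mult flip: right_diff_distrib)
qed

section \<open>Approximation by coefficients with bounded derivative\<close>

text \<open>The average over \<open>{t..t + h}\<close> looks only forward and so stays in the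
  half-line. Averaging commutes with translations, hence the bounds and the Hoelder constant are
  inherited without loss. The derivative bound degrades as \<open>h\<close> decreases, but
  \<open>h\<close> is fixed before the frequency.\<close>

lemma smoothing:
  fixes c\<^sub>0 :: "real \<Rightarrow> real"
  assumes c0: "c\<^sub>0 \<in> coefficients \<mu>\<^sub>1 \<mu>\<^sub>2 H \<alpha>" and "0 < \<alpha>" "0 \<le> H" "0 < h"
  obtains c c' L where
    "\<And>t. 0 \<le> t \<Longrightarrow> \<mu>\<^sub>1 \<le> c t \<and> c t \<le> \<mu>\<^sub>2" "\<And>t. 0 \<le> t \<Longrightarrow> \<bar>c t - c\<^sub>0 t\<bar> \<le> H * h powr \<alpha>"
    "\<And>t s. 0 \<le> t \<Longrightarrow> 0 \<le> s \<Longrightarrow> \<bar>c t - c s\<bar> \<le> H * \<bar>t - s\<bar> powr \<alpha>"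
    "\<And>t. 0 \<le> t \<Longrightarrow> (c has_real_derivative c' t) (at t within {0..})"
    "\<And>t. 0 \<le> t \<Longrightarrow> \<bar>c' t\<bar> \<le> L"
proof -
  define F where "F = (\<lambda>t. integral {0..t} c\<^sub>0)"
  define c where "c = (\<lambda>t. (F (t + h) - F t) / h)"
  have F: "(F has_real_derivative c\<^sub>0 t) (at t within {0..})" if "0 \<le> t" for t
  proof -
    have "(F has_real_derivative c\<^sub>0 t) (at t within {0..t + 1})"
      unfolding F_def using that
      by (intro integral_has_real_derivative
          continuous_on_subset[OF coefficients_continuous_on[OF c0 \<open>0 < \<alpha>\<close>]]) auto
    moreover have "at t within {0..t + 1} = at t within {0..}"
      by (rule at_within_nhd[of _ "{..<t + 1}"]) auto
    ultimately show ?thesis by simp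
  qed
  have Fh: "((\<lambda>r. F (t + r)) has_real_derivative c\<^sub>0 (t + r)) (at r within {0..})" if "0 \<le> t" "0 \<le> r" for t r
  proof -
    have "(F has_real_derivative c\<^sub>0 (t + r)) (at (t + r) within (+) t ` {0..})"
      by (rule DERIV_subset[OF F]) (use that in auto)
    moreover have "((+) t has_real_derivative 1) (at r within {0..})"
      by (rule derivative_eq_intros refl)+ simp
    ultimately show ?thesis
      using DERIV_image_chain by (fastforce simp: comp_def)
  qed
  \<comment> \<open>One mean value argument serves twice: \<open>z = 0\<close> represents a single
    value of \<open>c\<close>, and \<open>z = 1\<close> a difference with the same
    \<open>\<xi>\<close> at both points, which is what preserves the constant
    \<open>H\<close>.\<close>
  have mvt0: "\<exists>\<xi>\<in>{0<..<h}. c t - z * c s = c\<^sub>0 (t + \<xi>) - z * c\<^sub>0 (s + \<xi>)" if "0 \<le> t" "0 \<le> s" for t s z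
  proof -
    define G where "G = (\<lambda>r. F (t + r) - z * F (s + r))"
    have "(G has_derivative (*) (c\<^sub>0 (t + r) - z * c\<^sub>0 (s + r))) (at r within {0..h})" if "0 \<le> r" for r
      unfolding G_def has_field_derivative_def[symmetric]
      by (rule DERIV_subset[of _ _ _ "{0..}"])
        (intro DERIV_diff DERIV_cmult Fh \<open>0 \<le> t\<close> \<open>0 \<le> s\<close> that, auto)
    from mvt_simple[OF \<open>0 < h\<close> this] obtain \<xi> where "\<xi> \<in> {0<..<h}"
      "G h - G 0 = (c\<^sub>0 (t + \<xi>) - z * c\<^sub>0 (s + \<xi>)) * (h - 0)" by blast
    moreover have "c t - z * c s = (G h - G 0) / h"
      by (simp add: c_def G_def diff_divide_distrib right_diff_distrib)
    ultimately show ?thesis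
      using \<open>0 < h\<close> by (intro bexI[of _ \<xi>]) auto
  qed
  have c0H: "\<bar>c\<^sub>0 t - c\<^sub>0 s\<bar> \<le> H * \<bar>t - s\<bar> powr \<alpha>" if "0 \<le> t" "0 \<le> s" for t s
    using c0 that by (auto simp: coefficients_def)
  have mvt: "\<exists>\<xi>\<in>{0<..<h}. c t = c\<^sub>0 (t + \<xi>)" if "0 \<le> t" for t
    using mvt0[OF that that, of 0] by simp
  show ?thesis
  proof (rule that[of c "\<lambda>t. (c\<^sub>0 (t + h) - c\<^sub>0 t) / h" "(\<mu>\<^sub>2 - \<mu>\<^sub>1) / h"])
    fix t :: real assume t: "0 \<le> t"
    obtain \<xi> where \<xi>: "\<xi> \<in> {0<..<h}" "c t = c\<^sub>0 (t + \<xi>)"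
      using mvt[OF t] by blast
    show "\<mu>\<^sub>1 \<le> c t \<and> c t \<le> \<mu>\<^sub>2"
      using coefficients_bounds[OF c0, of "t + \<xi>"] \<xi> t by auto
    have "\<bar>c t - c\<^sub>0 t\<bar> \<le> H * \<bar>t + \<xi> - t\<bar> powr \<alpha>"
      unfolding \<xi>(2) by (rule c0H) (use t \<xi> in auto)
    also have "\<dots> \<le> H * h powr \<alpha>"
      using \<xi>(1) assms by (intro mult_left_mono powr_mono2) auto
    finally show "\<bar>c t - c\<^sub>0 t\<bar> \<le> H * h powr \<alpha>" .
    show "(c has_real_derivative (c\<^sub>0 (t + h) - c\<^sub>0 t) / h) (at t within {0..})"
    proof -
      have "((\<lambda>t. F (h + t)) has_real_derivative c\<^sub>0 (t + h)) (at t within {0..})"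
        using Fh[of h t] \<open>0 < h\<close> t by (simp add: add.commute)
      from DERIV_cdivide[OF DERIV_diff[OF this F[OF t]]] show ?thesis
        unfolding c_def by (simp add: add.commute)
    qed
    show "\<bar>(c\<^sub>0 (t + h) - c\<^sub>0 t) / h\<bar> \<le> (\<mu>\<^sub>2 - \<mu>\<^sub>1) / h"
      using coefficients_bounds[OF c0, of "t + h"] coefficients_bounds[OF c0, of t] t \<open>0 < h\<close>
      by (simp add: abs_le_iff divide_right_mono)
  next
    fix t s :: real assume "0 \<le> t" "0 \<le> s"
    with mvt0[of t s 1] obtain \<xi> where "\<xi> \<in> {0<..<h}" "c t - c s = c\<^sub>0 (t + \<xi>) - c\<^sub>0 (s + \<xi>)"
      by auto
    with c0H[of "t + \<xi>" "s + \<xi>"] \<open>0 \<le> t\<close> \<open>0 \<le> s\<close> show "\<bar>c t - c s\<bar> \<le> H * \<bar>t - s\<bar> powr \<alpha>"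
      by simp
  qed
qed

section \<open>The resonant coefficient and the growth of one mode\<close>

lemma ex_powr_le:
  fixes H \<alpha> e :: real
  assumes "0 < H" "0 < \<alpha>" "0 < e"
  shows "\<exists>h>0. H * h powr \<alpha> \<le> e"
proof (intro exI conjI)
  show "H * ((e / H) powr (1 / \<alpha>)) powr \<alpha> \<le> e"
    using assms by (simp add: powr_powr)
qed (use assms in simp)

text \<open>The order of quantifiers matters: rate \<open>\<kappa>\<close>, loss \<open>L\<close>
  and threshold \<open>\<Lambda>\<close> are fixed before \<open>l\<close>, while \<open>c\<close>
  may depend on \<open>l\<close>. The growth takes place before time \<open>1 / k\<close>, so it is
  felt throughout \<open>{1 / k..k}\<close>.\<close>

lemma resonant_coefficient:
  fixes \<alpha> \<mu>\<^sub>1 \<mu>\<^sub>2 H \<epsilon> k :: real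
  assumes \<alpha>: "0 < \<alpha>" "\<alpha> < 1" and \<mu>: "0 < \<mu>\<^sub>1" "\<mu>\<^sub>1 < \<mu>\<^sub>2" and "0 < H" "0 < \<epsilon>" "0 < k"
    and c0: "c\<^sub>0 \<in> coefficients \<mu>\<^sub>1 \<mu>\<^sub>2 H \<alpha>"
  shows "\<exists>\<kappa>>0. \<exists>L \<Lambda>. \<forall>l\<ge>\<Lambda>. \<exists>c\<in>coefficients \<mu>\<^sub>1 \<mu>\<^sub>2 H \<alpha>. coefficients_dist c\<^sub>0 c \<le> \<epsilon> \<and>
    (\<forall>u u' t. solves_on {0..} (\<lambda>t. l\<^sup>2 * c t) u u' \<longrightarrow> u 0 = 0 \<longrightarrow> t \<in> {1 / k..k} \<longrightarrow>
       (u' 0)\<^sup>2 * exp (\<kappa> * l powr (1 - \<alpha>) - L) \<le> (1 + l\<^sup>2 * \<mu>\<^sub>2) * ((u t)\<^sup>2 + (u' t)\<^sup>2))"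
proof -
  \<comment> \<open>Moving a fraction \<open>\<theta>\<close> of the way towards the constant
    \<open>m\<close> frees the share \<open>\<theta> * H\<close> of the Hoelder constant and a
    margin \<open>\<nu>\<close> from both end values; the second entry limits the displacement to a
    quarter of \<open>\<epsilon>\<close>.\<close>
  define \<theta> where "\<theta> = min (1 / 2) (\<epsilon> / 4 / (\<mu>\<^sub>2 - \<mu>\<^sub>1))"
  have \<theta>: "0 < \<theta>" "\<theta> < 1" "\<theta> * (\<mu>\<^sub>2 - \<mu>\<^sub>1) \<le> \<epsilon> / 4"
    using \<mu> \<open>0 < \<epsilon>\<close> by (auto simp: \<theta>_def min_def field_simps)
  \<comment> \<open>Four errors of size \<open>e\<close> add up in the distance: time shift,
    averaging, convex combination, oscillation.\<close>
  define e where "e = \<epsilon> / 4"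
  have "0 < e" using \<open>0 < \<epsilon>\<close> by (simp add: e_def)
  obtain h where h: "0 < h" "H * h powr \<alpha> \<le> e"
    using ex_powr_le[OF \<open>0 < H\<close> \<alpha>(1) \<open>0 < e\<close>] by blast
  obtain b b' L where b: "\<And>t. 0 \<le> t \<Longrightarrow> \<mu>\<^sub>1 \<le> b t \<and> b t \<le> \<mu>\<^sub>2"
    and bc: "\<And>t. 0 \<le> t \<Longrightarrow> \<bar>b t - c\<^sub>0 t\<bar> \<le> H * h powr \<alpha>"
    and bH: "\<And>t s. 0 \<le> t \<Longrightarrow> 0 \<le> s \<Longrightarrow> \<bar>b t - b s\<bar> \<le> H * \<bar>t - s\<bar> powr \<alpha>"
    and b': "\<And>t. 0 \<le> t \<Longrightarrow> (b has_real_derivative b' t) (at t within {0..})"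
    and L: "\<And>t. 0 \<le> t \<Longrightarrow> \<bar>b' t\<bar> \<le> L"
    using smoothing[OF c0 \<alpha>(1) less_imp_le[OF \<open>0 < H\<close>] h(1)] by metis
  have "0 \<le> L" using L[of 0] by simp
  \<comment> \<open>\<open>T \<le> h\<close> bounds the error of shifting \<open>c\<^sub>0\<close>
    in time, and \<open>T \<le> 1 / k\<close> ends the oscillation before the window opens.\<close>
  define T where "T = min h (1 / k)"
  have T: "0 < T" "T \<le> 1 / k" "H * T powr \<alpha> \<le> e"
  proof -
    show "0 < T" "T \<le> 1 / k" using h \<open>0 < k\<close> by (auto simp: T_def)
    then have "H * T powr \<alpha> \<le> H * h powr \<alpha>"
      using \<open>0 < H\<close> \<alpha> by (intro mult_left_mono powr_mono2) (auto simp: T_def)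
    then show "H * T powr \<alpha> \<le> e" using h by simp
  qed
  define m where "m = (\<mu>\<^sub>1 + \<mu>\<^sub>2) / 2"
  define B where "B = (\<lambda>t. (1 - \<theta>) * b t + \<theta> * m)"
  define \<nu> where "\<nu> = \<theta> * (\<mu>\<^sub>2 - \<mu>\<^sub>1) / 2"
  have "0 < \<nu>" using \<theta> \<mu> by (simp add: \<nu>_def)
  have B: "\<mu>\<^sub>1 + \<nu> \<le> B t" "B t \<le> \<mu>\<^sub>2 - \<nu>" if "0 \<le> t" for t
  proof -
    have "(1 - \<theta>) * \<mu>\<^sub>1 \<le> (1 - \<theta>) * b t" "(1 - \<theta>) * b t \<le> (1 - \<theta>) * \<mu>\<^sub>2"
      using b[OF that] \<theta> by (auto intro: mult_left_mono)
    then show "\<mu>\<^sub>1 + \<nu> \<le> B t" "B t \<le> \<mu>\<^sub>2 - \<nu>"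
      by (simp_all add: B_def \<nu>_def m_def field_simps)
  qed
  have Bb: "\<bar>B t - b t\<bar> \<le> e" if "0 \<le> t" for t
  proof -
    have "B t - b t = \<theta> * (m - b t)"
      by (simp add: B_def algebra_simps)
    then have "\<bar>B t - b t\<bar> = \<theta> * \<bar>m - b t\<bar>"
      using \<theta> by (simp add: abs_mult)
    also have "\<dots> \<le> \<theta> * (\<mu>\<^sub>2 - \<mu>\<^sub>1)"
      using b[OF that] \<theta> by (intro mult_left_mono) (auto simp: m_def abs_le_iff field_simps)
    finally show ?thesis using \<theta> by (simp add: e_def)
  qed
  have BH: "\<bar>B t - B s\<bar> \<le> (1 - \<theta>) * H * \<bar>t - s\<bar> powr \<alpha>" if "0 \<le> t" "0 \<le> s" for t s
  proof -
    have "\<bar>B t - B s\<bar> = (1 - \<theta>) * \<bar>b t - b s\<bar>"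
      using \<theta> by (simp add: B_def abs_mult flip: right_diff_distrib)
    also have "\<dots> \<le> (1 - \<theta>) * (H * \<bar>t - s\<bar> powr \<alpha>)"
      using bH[OF that] \<theta> by (intro mult_left_mono) auto
    finally show ?thesis by (simp add: mult.assoc)
  qed
  \<comment> \<open>\<open>B 0\<close> will be the mean coefficient on the initial interval, so
    \<open>\<gamma> * l\<close> is the natural frequency there.\<close>
  define \<gamma> where "\<gamma> = sqrt (B 0)"
  have \<gamma>: "0 < \<gamma>" "\<gamma>\<^sup>2 = B 0"
    using B[of 0] \<mu> \<open>0 < \<nu>\<close> by (auto simp: \<gamma>_def)
  \<comment> \<open>In order: the values stay in the allowed interval, the distance stays small, and
    the oscillation stays within the freed share \<open>\<theta> * H\<close>.\<close>
  define \<rho> where "\<rho> = min (min \<nu> e) (\<theta> * H / (2 * \<gamma> powr \<alpha>))"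
  have \<rho>: "0 < \<rho>" "\<rho> \<le> \<nu>" "\<rho> \<le> e" "2 * \<rho> * \<gamma> powr \<alpha> \<le> \<theta> * H"
  proof -
    show "0 < \<rho>" using \<open>0 < \<nu>\<close> \<open>0 < e\<close> \<theta> \<open>0 < H\<close> \<gamma> by (simp add: \<rho>_def)
    have "\<rho> \<le> \<theta> * H / (2 * \<gamma> powr \<alpha>)" by (simp add: \<rho>_def)
    then show "2 * \<rho> * \<gamma> powr \<alpha> \<le> \<theta> * H" using \<gamma> by (simp add: field_simps)
  qed (auto simp: \<rho>_def)
  \<comment> \<open>With \<open>\<delta>\<close> at most 1 the quadratic term is at most
    \<open>4 * \<delta>\<close>, whence the denominator.\<close>
  define \<delta> where "\<delta> = min 1 (\<rho> / (4 * (\<gamma> + 1)))"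
  have \<delta>: "0 < \<delta>" "4 * \<delta> * \<gamma> + 4 * \<delta>\<^sup>2 \<le> \<rho>"
  proof -
    show "0 < \<delta>" using \<rho> \<gamma> by (simp add: \<delta>_def)
    have "\<delta> * \<delta> \<le> \<delta> * 1"
      using \<open>0 < \<delta>\<close> by (intro mult_left_mono) (auto simp: \<delta>_def)
    moreover have "\<delta> \<le> \<rho> / (4 * (\<gamma> + 1))" by (simp add: \<delta>_def)
    then have "4 * \<delta> * \<gamma> + 4 * \<delta> \<le> \<rho>" using \<gamma> by (simp add: field_simps)
    ultimately show "4 * \<delta> * \<gamma> + 4 * \<delta>\<^sup>2 \<le> \<rho>" by (simp add: power2_eq_square)
  qed
  \<comment> \<open>A full period of the sine then fits into \<open>T\<close>, so cutting at its
    last zero keeps at least half of the interval.\<close>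
  define \<Lambda> where "\<Lambda> = max 1 (2 * pi / (\<gamma> * T))"
  have main: "\<exists>c\<in>coefficients \<mu>\<^sub>1 \<mu>\<^sub>2 H \<alpha>. coefficients_dist c\<^sub>0 c \<le> \<epsilon> \<and>
    (\<forall>u u' t. solves_on {0..} (\<lambda>t. l\<^sup>2 * c t) u u' \<longrightarrow> u 0 = 0 \<longrightarrow> t \<in> {1 / k..k} \<longrightarrow>
       (u' 0)\<^sup>2 * exp (\<delta> * T / 2 * l powr (1 - \<alpha>) - L / \<mu>\<^sub>1 * k) \<le> (1 + l\<^sup>2 * \<mu>\<^sub>2) * ((u t)\<^sup>2 + (u' t)\<^sup>2))"
    if l: "\<Lambda> \<le> l" for l
  proof -
    have l1: "1 \<le> l" "2 * pi / (\<gamma> * T) \<le> l" using l by (auto simp: \<Lambda>_def)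
    \<comment> \<open>\<open>\<tau>\<close> is the largest zero of \<open>sin (\<omega> t)\<close> up to \<open>T\<close>, so that the oscillation stops continuously.\<close>
    define a \<omega> where "a = \<delta> * l powr (1 - \<alpha>)" and "\<omega> = \<gamma> * l"
    have a: "0 < a" and \<omega>: "0 < \<omega>" using \<delta> \<gamma> l1 by (auto simp: a_def \<omega>_def)
    define n where "n = nat \<lfloor>\<omega> * T / pi\<rfloor>"
    define \<tau> where "\<tau> = pi * real n / \<omega>"
    have n: "real n \<le> \<omega> * T / pi" "\<omega> * T / pi - 1 \<le> real n"
      using \<omega> T by (simp_all add: n_def)
    have \<tau>: "0 \<le> \<tau>" "\<tau> \<le> T" "T / 2 \<le> \<tau>" "\<omega> * \<tau> = pi * real n"
    proof -
      show "0 \<le> \<tau>" "\<omega> * \<tau> = pi * real n" using \<omega> by (simp_all add: \<tau>_def)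
      show "\<tau> \<le> T" using n(1) \<omega> by (simp add: \<tau>_def field_simps)
      have "\<omega> * T - pi \<le> \<omega> * \<tau>" using n(2) \<omega> by (simp add: \<tau>_def field_simps)
      moreover have "2 * pi \<le> \<omega> * T" using l1(2) \<gamma> T by (simp add: \<omega>_def field_simps)
      ultimately have "\<omega> * (T / 2) \<le> \<omega> * \<tau>" by simp
      then show "T / 2 \<le> \<tau>" using \<omega> by simp
    qed
    define f where "f = (\<lambda>t. 4 * a * \<omega> * sin (\<omega> * t) * cos (\<omega> * t) + a\<^sup>2 * sin (\<omega> * t) ^ 4)"
    define M where "M = 4 * a * \<omega> + 4 * a\<^sup>2"
    have f: "\<bar>f t\<bar> \<le> M" "\<bar>f t - f s\<bar> \<le> M * (\<omega> * \<bar>t - s\<bar>)" for t s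
      unfolding f_def M_def using a \<omega> by (intro resonant_term_bounds; simp)+
    have fH: "\<bar>f t - f s\<bar> \<le> 2 * M * (\<omega> * \<bar>t - s\<bar>) powr \<alpha>" for t s
      by (rule lipschitz_bounded_imp_holder[of f, OF f(1) f(1) f(2)]) (use \<alpha> \<omega> in auto)
    have f\<tau>: "f \<tau> = 0" by (simp add: f_def \<tau>(4))
    \<comment> \<open>The amplitude \<open>l powr - \<alpha>\<close> arises here:
      \<open>a * \<omega>\<close> is of order \<open>l powr (2 - \<alpha>)\<close>, and
      \<open>a\<^sup>2\<close> is of lower order.\<close>
    have M: "M / l\<^sup>2 \<le> \<rho> * l powr - \<alpha>"
    proof -
      have l2: "l\<^sup>2 = l powr 2" using l1 by simp
      have pw: "l powr (1 - \<alpha>) * l = l powr (2 - \<alpha>)"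
        "l powr (1 - \<alpha>) * l powr (1 - \<alpha>) = l powr (2 - 2 * \<alpha>)"
        using powr_add[of l "1 - \<alpha>" 1] powr_add[of l "1 - \<alpha>" "1 - \<alpha>"] l1 by simp_all
      have "M = 4 * \<delta> * \<gamma> * (l powr (1 - \<alpha>) * l) + 4 * \<delta>\<^sup>2 * (l powr (1 - \<alpha>) * l powr (1 - \<alpha>))"
        by (simp add: M_def a_def \<omega>_def power2_eq_square algebra_simps)
      also have "\<dots> = 4 * \<delta> * \<gamma> * l powr (2 - \<alpha>) + 4 * \<delta>\<^sup>2 * l powr (2 - 2 * \<alpha>)"
        unfolding pw ..
      also have "\<dots> \<le> 4 * \<delta> * \<gamma> * l powr (2 - \<alpha>) + 4 * \<delta>\<^sup>2 * l powr (2 - \<alpha>)"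
        using l1 \<alpha> by (intro add_left_mono mult_left_mono powr_mono) auto
      also have "\<dots> \<le> \<rho> * l powr (2 - \<alpha>)"
        using \<delta>(2) unfolding distrib_right[symmetric] by (intro mult_right_mono) auto
      finally have "M / l\<^sup>2 \<le> \<rho> * l powr (2 - \<alpha>) / l\<^sup>2"
        by (rule divide_right_mono) simp
      also have "\<dots> = \<rho> * l powr - \<alpha>"
        unfolding l2 times_divide_eq_right[symmetric] by (simp flip: powr_diff)
      finally show ?thesis .
    qed
    have "l powr - \<alpha> \<le> 1"
      using l1 \<alpha> by (simp add: powr_minus field_simps ge_one_powr_ge_zero)
    then have "\<rho> * l powr - \<alpha> \<le> \<rho>" using \<rho> by (simp add: mult_left_le)
    with M have M\<rho>: "M / l\<^sup>2 \<le> \<rho>" by linarith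
    have f\<rho>: "\<bar>f t / l\<^sup>2\<bar> \<le> \<rho>" for t
    proof -
      have "\<bar>f t / l\<^sup>2\<bar> \<le> M / l\<^sup>2"
        using f(1)[of t] by (simp add: abs_divide divide_right_mono)
      then show ?thesis using M\<rho> by linarith
    qed
    \<comment> \<open>The factor \<open>l powr \<alpha>\<close> produced by the frequency cancels
      against the amplitude \<open>l powr - \<alpha>\<close>, so the Hoelder constant is independent
      of \<open>l\<close>.\<close>
    have fH': "\<bar>f t / l\<^sup>2 - f s / l\<^sup>2\<bar> \<le> \<theta> * H * \<bar>t - s\<bar> powr \<alpha>" for t s
    proof -
      have "\<bar>f t / l\<^sup>2 - f s / l\<^sup>2\<bar> = \<bar>f t - f s\<bar> / l\<^sup>2"
        by (simp add: abs_divide flip: diff_divide_distrib)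
      also have "\<dots> \<le> 2 * M * (\<omega> * \<bar>t - s\<bar>) powr \<alpha> / l\<^sup>2"
        by (intro divide_right_mono fH) auto
      also have "\<dots> = (M / l\<^sup>2) * (2 * \<gamma> powr \<alpha> * l powr \<alpha> * \<bar>t - s\<bar> powr \<alpha>)"
        using \<gamma> l1 by (simp add: \<omega>_def powr_mult)
      also have "\<dots> \<le> (\<rho> * l powr - \<alpha>) * (2 * \<gamma> powr \<alpha> * l powr \<alpha> * \<bar>t - s\<bar> powr \<alpha>)"
        by (intro mult_right_mono M) auto
      also have "\<dots> = 2 * \<rho> * \<gamma> powr \<alpha> * \<bar>t - s\<bar> powr \<alpha>"
        using l1 by (simp add: powr_minus field_simps)
      also have "\<dots> \<le> \<theta> * H * \<bar>t - s\<bar> powr \<alpha>"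
        by (intro mult_right_mono \<rho>) auto
      finally show ?thesis .
    qed
    \<comment> \<open>Both summands are compositions with 1-Lipschitz maps, hence their Hoelder constants add up to \<open>H\<close>.\<close>
    define g where "g = (\<lambda>t. B (max 0 (t - \<tau>)) - f (min t \<tau>) / l\<^sup>2)"
    define c where "c = restrict g {0..}"
    have c: "c t = g t" if "0 \<le> t" for t using that by (simp add: c_def)
    have cF: "c \<in> coefficients \<mu>\<^sub>1 \<mu>\<^sub>2 H \<alpha>"
      unfolding coefficients_def
    proof (intro CollectI conjI PiE_I allI impI)
      fix t :: real assume "t \<in> {0..}"
      moreover have "\<mu>\<^sub>1 \<le> g t" "g t \<le> \<mu>\<^sub>2"
        using B[of "max 0 (t - \<tau>)"] f\<rho>[of "min t \<tau>"] \<rho> unfolding g_def by linarith+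
      ultimately show "c t \<in> {\<mu>\<^sub>1..\<mu>\<^sub>2}"
        by (simp add: c)
    next
      fix t s :: real assume ts: "0 \<le> t" "0 \<le> s"
      have "\<bar>c t - c s\<bar> \<le> \<bar>B (max 0 (t - \<tau>)) - B (max 0 (s - \<tau>))\<bar>
          + \<bar>f (min t \<tau>) / l\<^sup>2 - f (min s \<tau>) / l\<^sup>2\<bar>"
        unfolding c[OF ts(1)] c[OF ts(2)] g_def by linarith
      also have "\<dots> \<le> (1 - \<theta>) * H * \<bar>max 0 (t - \<tau>) - max 0 (s - \<tau>)\<bar> powr \<alpha>
          + \<theta> * H * \<bar>min t \<tau> - min s \<tau>\<bar> powr \<alpha>"
        by (intro add_mono BH fH') auto
      also have "\<dots> \<le> (1 - \<theta>) * H * \<bar>t - s\<bar> powr \<alpha> + \<theta> * H * \<bar>t - s\<bar> powr \<alpha>"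
        using \<theta> \<open>0 < H\<close> \<alpha> by (intro add_mono mult_left_mono powr_mono2) auto
      also have "\<dots> = H * \<bar>t - s\<bar> powr \<alpha>" by (simp add: algebra_simps)
      finally show "\<bar>c t - c s\<bar> \<le> H * \<bar>t - s\<bar> powr \<alpha>" .
    qed (simp add: c_def)
    have dist: "coefficients_dist c\<^sub>0 c \<le> \<epsilon>"
    proof (rule coefficients_dist_least)
      fix t :: real assume t: "0 \<le> t"
      \<comment> \<open>\<open>r\<close> is the time at which \<open>B\<close> is evaluated; it lags
        behind \<open>t\<close> by at most \<open>\<tau>\<close>.\<close>
      define r where "r = max 0 (t - \<tau>)"
      have r: "0 \<le> r" "\<bar>t - r\<bar> \<le> T" using t \<tau> by (auto simp: r_def)
      have "\<bar>c\<^sub>0 t - c\<^sub>0 r\<bar> \<le> H * \<bar>t - r\<bar> powr \<alpha>"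
        using c0 t r by (auto simp: coefficients_def)
      also have "\<dots> \<le> H * T powr \<alpha>"
        using r \<open>0 < H\<close> \<alpha> by (intro mult_left_mono powr_mono2) auto
      finally have "\<bar>c\<^sub>0 t - c\<^sub>0 r\<bar> \<le> e" using T by simp
      moreover have "\<bar>b r - c\<^sub>0 r\<bar> \<le> e" using bc[OF r(1)] h by simp
      moreover have "\<bar>B r - b r\<bar> \<le> e" by (rule Bb[OF r(1)])
      moreover have "\<bar>f (min t \<tau>) / l\<^sup>2\<bar> \<le> e" using f\<rho>[of "min t \<tau>"] \<rho> by simp
      moreover have "c t = B r - f (min t \<tau>) / l\<^sup>2" using t by (simp add: c g_def r_def)
      ultimately show "\<bar>c\<^sub>0 t - c t\<bar> \<le> \<epsilon>" unfolding e_def by linarith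
    qed
    have growth: "(u' 0)\<^sup>2 * exp (\<delta> * T / 2 * l powr (1 - \<alpha>) - L / \<mu>\<^sub>1 * k) \<le>
        (1 + l\<^sup>2 * \<mu>\<^sub>2) * ((u t)\<^sup>2 + (u' t)\<^sup>2)"
      if sol: "solves_on {0..} (\<lambda>t. l\<^sup>2 * c t) u u'" and u0: "u 0 = 0" and t: "t \<in> {1 / k..k}" for u u' t
    proof -
      have \<tau>t: "\<tau> \<le> t" using \<tau> T t by auto
      define \<eta> where "\<eta> = (\<lambda>t. a * (t / 2 - sin (\<omega> * t) * cos (\<omega> * t) / (2 * \<omega>)))"
      define v v' where "v = (\<lambda>t. u' 0 / \<omega> * sin (\<omega> * t) * exp (\<eta> t))"
        and "v' = (\<lambda>t. u' 0 / \<omega> * (\<omega> * cos (\<omega> * t) + a * sin (\<omega> * t) ^ 3) * exp (\<eta> t))"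
      have "solves_on {0..\<tau>} (\<lambda>t. \<omega>\<^sup>2 - f t) v v'"
        unfolding v_def v'_def f_def \<eta>_def by (rule resonant_solution[OF \<omega>])
      \<comment> \<open>Up to \<open>\<tau>\<close> the argument of \<open>B\<close> is 0, and
        \<open>l\<^sup>2 * B 0\<close> equals \<open>\<omega>\<^sup>2\<close>.\<close>
      moreover have "\<omega>\<^sup>2 - f t = l\<^sup>2 * c t" if "t \<in> {0..\<tau>}" for t
        using that \<gamma>(2) l1 by (simp add: c g_def \<omega>_def power_mult_distrib algebra_simps)
      ultimately have vsol: "solves_on {0..\<tau>} (\<lambda>t. l\<^sup>2 * c t) v v'"
        by (simp add: solves_on_def)
      have "u' \<tau> = v' \<tau>"
      proof (rule solution_unique(2)[OF solves_on_subset[OF sol] vsol])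
        show "u 0 = v 0" "u' 0 = v' 0" using u0 \<omega> by (simp_all add: v_def v'_def \<eta>_def)
        show "\<bar>l\<^sup>2 * c t\<bar> \<le> l\<^sup>2 * \<mu>\<^sub>2" if "t \<in> {0..\<tau>}" for t
          using coefficients_mult_bound[OF cF \<mu>(1)] that by auto
      qed (use \<tau> in auto)
      \<comment> \<open>At \<open>\<tau>\<close> the sine vanishes: the exponent is exactly
        \<open>a * \<tau> / 2\<close>, and the whole energy sits in \<open>u'\<close>, so starting
        the next estimate from \<open>(u' \<tau>)\<^sup>2\<close> loses nothing.\<close>
      also have "v' \<tau> = u' 0 * cos (pi * real n) * exp (a * \<tau> / 2)"
        using \<omega> by (simp add: v'_def \<eta>_def \<tau>(4))
      moreover have "(cos (pi * real n))\<^sup>2 = 1"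
        by (simp add: power2_eq_square flip: power_mult_distrib)
      ultimately have u'\<tau>: "(u' \<tau>)\<^sup>2 = (u' 0)\<^sup>2 * exp (a * \<tau>)"
        by (simp only: power_mult_distrib flip: exp_double) simp
      have "(u' \<tau>)\<^sup>2 * exp (- (L / \<mu>\<^sub>1) * (t - \<tau>)) \<le>
          (1 + l\<^sup>2 * \<mu>\<^sub>2) * ((u t)\<^sup>2 + (u' t)\<^sup>2)"
      proof (rule solution_growth_lower)
        fix s assume s: "s \<in> {\<tau>..t}"
        have "((\<lambda>s. b (s - \<tau>)) has_real_derivative b' (s - \<tau>)) (at s within {\<tau>..t})"
        proof -
          have "(b has_real_derivative b' (s - \<tau>)) (at (s - \<tau>) within (\<lambda>s. s - \<tau>) ` {\<tau>..t})"
            by (rule DERIV_subset[OF b']) (use s in auto)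
          moreover have "((\<lambda>s. s - \<tau>) has_real_derivative 1) (at s within {\<tau>..t})"
            by (rule derivative_eq_intros refl)+ simp
          ultimately show ?thesis
            using DERIV_image_chain by (fastforce simp: comp_def)
        qed
        then have "((\<lambda>s. B (s - \<tau>)) has_real_derivative (1 - \<theta>) * b' (s - \<tau>)) (at s within {\<tau>..t})"
          unfolding B_def by (auto intro!: derivative_eq_intros)
        \<comment> \<open>From \<open>\<tau>\<close> on the oscillating part is frozen at
          \<open>f \<tau> = 0\<close>. A kink of \<open>c\<close> at \<open>\<tau>\<close> is
          harmless, since only the derivative from the right enters.\<close>
        then show "(c has_real_derivative (1 - \<theta>) * b' (s - \<tau>)) (at s within {\<tau>..t})"
          by (rule has_real_derivative_transform_on[OF _ s]) (use \<tau> in \<open>auto simp: c g_def f\<tau>\<close>)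
        have "(1 - \<theta>) * \<bar>b' (s - \<tau>)\<bar> \<le> 1 * L"
          using L[of "s - \<tau>"] s \<theta> by (intro mult_mono) auto
        then show "\<bar>(1 - \<theta>) * b' (s - \<tau>)\<bar> \<le> L"
          using \<theta> by (simp add: abs_mult)
        show "\<mu>\<^sub>1 \<le> c s" "c s \<le> \<mu>\<^sub>2"
          using coefficients_bounds[OF cF, of s] s \<tau> by auto
      qed (use \<tau> \<tau>t \<mu> in \<open>auto intro: solves_on_subset[OF sol]\<close>)
      moreover have "(u' 0)\<^sup>2 * exp (\<delta> * T / 2 * l powr (1 - \<alpha>) - L / \<mu>\<^sub>1 * k) \<le>
          (u' 0)\<^sup>2 * exp (a * \<tau> + (- (L / \<mu>\<^sub>1) * (t - \<tau>)))"
      proof -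
        have "a * (T / 2) \<le> a * \<tau>" using \<tau> a by simp
        moreover have "L / \<mu>\<^sub>1 * (t - \<tau>) \<le> L / \<mu>\<^sub>1 * k"
          using \<open>0 \<le> L\<close> \<mu> t \<tau> by (intro mult_left_mono) auto
        moreover have "\<delta> * T / 2 * l powr (1 - \<alpha>) = a * (T / 2)"
          by (simp add: a_def)
        ultimately have "\<delta> * T / 2 * l powr (1 - \<alpha>) - L / \<mu>\<^sub>1 * k \<le> a * \<tau> + (- (L / \<mu>\<^sub>1) * (t - \<tau>))"
          unfolding mult_minus_left by linarith
        then show ?thesis by (intro mult_left_mono) auto
      qed
      ultimately show ?thesis unfolding u'\<tau> exp_add mult.assoc by linarith
    qed
    show ?thesis
      by (intro bexI[OF _ cF] conjI dist allI impI growth)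
  qed
  have "0 < \<delta> * T / 2" using \<delta> T by simp
  moreover have "\<exists>L \<Lambda>. \<forall>l\<ge>\<Lambda>. \<exists>c\<in>coefficients \<mu>\<^sub>1 \<mu>\<^sub>2 H \<alpha>. coefficients_dist c\<^sub>0 c \<le> \<epsilon> \<and>
    (\<forall>u u' t. solves_on {0..} (\<lambda>t. l\<^sup>2 * c t) u u' \<longrightarrow> u 0 = 0 \<longrightarrow> t \<in> {1 / k..k} \<longrightarrow>
       (u' 0)\<^sup>2 * exp (\<delta> * T / 2 * l powr (1 - \<alpha>) - L) \<le> (1 + l\<^sup>2 * \<mu>\<^sub>2) * ((u t)\<^sup>2 + (u' t)\<^sup>2))"
    by (rule exI[of _ "L / \<mu>\<^sub>1 * k"], rule exI[of _ \<Lambda>], intro allI impI, rule main)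
  ultimately show ?thesis
    by - (rule exI[of _ "\<delta> * T / 2"], rule conjI)
qed

section \<open>Empty interior of the exceptional sets\<close>

text \<open>After taking logarithms, \<open>\<kappa> * l powr g\<close> beats every other term; the
  strict inequality \<open>b < g\<close> also absorbs the factor \<open>ln (1 + l)\<close>.\<close>

lemma exp_growth_dominates:
  fixes a b g \<kappa> L k \<mu> \<eta> :: real
  assumes "0 < a" "a < g" "0 < b" "b < g" "0 < \<kappa>" "0 < k" "0 < \<mu>" "0 < \<eta>"
  shows "\<forall>\<^sub>F l in at_top. k * exp (2 * k * l powr a) * (1 + l\<^sup>2 * \<mu>) <
           \<eta>\<^sup>2 * exp (- (l powr b * ln (1 + l))) * exp (\<kappa> * l powr g - L)"
proof -
  have "\<forall>\<^sub>F l in at_top. ln k + 2 * k * l powr a + ln (1 + l\<^sup>2 * \<mu>) <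
           ln (\<eta>\<^sup>2) - l powr b * ln (1 + l) + (\<kappa> * l powr g - L)"
    using assms by real_asymp
  then show ?thesis
  proof eventually_elim
    case (elim l)
    have pos: "0 < 1 + l\<^sup>2 * \<mu>" using assms by (simp add: add_pos_nonneg)
    have "exp (ln k + 2 * k * l powr a + ln (1 + l\<^sup>2 * \<mu>)) <
        exp (ln (\<eta>\<^sup>2) + - (l powr b * ln (1 + l)) + (\<kappa> * l powr g - L))"
      using elim by simp
    then show ?case
      using assms pos by (simp only: exp_add exp_ln zero_less_power)
  qed
qed

lemma gevrey_inf_single:
  "(\<lambda>j. if j = i then x else 0) \<in> gevrey_inf lam s"
  "gevrey_inf_norm lam s (\<lambda>j. if j = i then x else 0) =
     \<bar>x\<bar> * sqrt (exp (lam i powr (1 / s) * ln (1 + lam i)))"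
proof -
  let ?w = "\<lambda>i. exp (lam i powr (1 / s) * ln (1 + lam i))"
  have "(\<lambda>j. (if j = i then x else 0)\<^sup>2 * ?w j) = (\<lambda>j. if j = i then x\<^sup>2 * ?w j else 0)"
    by auto
  with sums_single[of i "\<lambda>j. x\<^sup>2 * ?w j"]
  have *: "(\<lambda>j. (if j = i then x else 0)\<^sup>2 * ?w j) sums (x\<^sup>2 * ?w i)"
    by simp
  show "(\<lambda>j. if j = i then x else 0) \<in> gevrey_inf lam s"
    using * by (auto simp: gevrey_inf_def sums_iff)
  show "gevrey_inf_norm lam s (\<lambda>j. if j = i then x else 0) = \<bar>x\<bar> * sqrt (?w i)"
    using sums_unique[OF *, symmetric] by (simp add: gevrey_inf_norm_def real_sqrt_mult)
qed

lemma interior_of_tame_set: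
  fixes \<alpha> \<beta> B \<mu>\<^sub>1 \<mu>\<^sub>2 H k :: real and lam :: "nat \<Rightarrow> real"
  assumes \<alpha>: "0 < \<alpha>" "\<alpha> < 1" and \<beta>: "1 / (1 - \<alpha>) < \<beta>" and B: "1 / (1 - \<alpha>) < B"
    and \<mu>: "0 < \<mu>\<^sub>1" "\<mu>\<^sub>1 < \<mu>\<^sub>2" and "0 < H" "0 < k"
    and lam: "filterlim lam at_top sequentially"
  defines "X \<equiv> X_space \<mu>\<^sub>1 \<mu>\<^sub>2 H \<alpha> lam \<beta>" and "d \<equiv> X_dist \<mu>\<^sub>1 \<mu>\<^sub>2 H \<alpha> lam \<beta>"
  shows "Metric_space.mtopology X d interior_of (tame_set X lam B k) = {}"
proof (rule equals0I)
  interpret X: Metric_space X d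
    unfolding X_def d_def by (rule Metric_space_X)
  fix p assume p: "p \<in> X.mtopology interior_of (tame_set X lam B k)"
  obtain c\<^sub>0 \<psi>\<^sub>0 where p_eq: "p = (c\<^sub>0, \<psi>\<^sub>0)" by fastforce
  obtain \<epsilon> where pX: "(c\<^sub>0, \<psi>\<^sub>0) \<in> X" and "0 < \<epsilon>" and ball: "X.mball (c\<^sub>0, \<psi>\<^sub>0) \<epsilon> \<subseteq> tame_set X lam B k"
    using p unfolding X.in_interior_of_mball p_eq by blast
  have c0: "c\<^sub>0 \<in> coefficients \<mu>\<^sub>1 \<mu>\<^sub>2 H \<alpha>" and \<psi>0: "\<psi>\<^sub>0 \<in> gevrey_inf lam \<beta>"
    using pX by (auto simp: X_def X_space_def)
  \<comment> \<open>Coefficient and datum are each moved by at most \<open>\<eta>\<close>, two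
    thirds of the radius in total.\<close>
  define \<eta> where "\<eta> = \<epsilon> / 3"
  have "0 < \<eta>" using \<open>0 < \<epsilon>\<close> by (simp add: \<eta>_def)
  obtain \<kappa> L \<Lambda> where "0 < \<kappa>" and res: "\<forall>l\<ge>\<Lambda>. \<exists>c\<in>coefficients \<mu>\<^sub>1 \<mu>\<^sub>2 H \<alpha>. coefficients_dist c\<^sub>0 c \<le> \<eta> \<and>
    (\<forall>u u' t. solves_on {0..} (\<lambda>t. l\<^sup>2 * c t) u u' \<longrightarrow> u 0 = 0 \<longrightarrow> t \<in> {1 / k..k} \<longrightarrow>
       (u' 0)\<^sup>2 * exp (\<kappa> * l powr (1 - \<alpha>) - L) \<le> (1 + l\<^sup>2 * \<mu>\<^sub>2) * ((u t)\<^sup>2 + (u' t)\<^sup>2))"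
    using resonant_coefficient[OF \<alpha> \<mu> \<open>0 < H\<close> \<open>0 < \<eta>\<close> \<open>0 < k\<close> c0] by blast
  have inv: "0 < 1 / r" "1 / r < 1 - \<alpha>" if "1 / (1 - \<alpha>) < r" for r
  proof -
    have "0 < 1 / (1 - \<alpha>)" using \<alpha> by simp
    then have "0 < r" using that by linarith
    then show "0 < 1 / r" "1 / r < 1 - \<alpha>" using that \<alpha> by (simp_all add: field_simps)
  qed
  have "\<forall>\<^sub>F l in at_top. \<Lambda> \<le> l \<and> k * exp (2 * k * l powr (1 / B)) * (1 + l\<^sup>2 * \<mu>\<^sub>2) <
           \<eta>\<^sup>2 * exp (- (l powr (1 / \<beta>) * ln (1 + l))) * exp (\<kappa> * l powr (1 - \<alpha>) - L)"
    using \<mu> \<open>0 < \<kappa>\<close> \<open>0 < k\<close> \<open>0 < \<eta>\<close>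
    by (intro eventually_conj eventually_ge_at_top exp_growth_dominates inv[OF \<beta>] inv[OF B]) auto
  from eventually_happens'[OF _ eventually_compose_filterlim[OF this lam]]
  obtain i where i: "\<Lambda> \<le> lam i"
    "k * exp (2 * k * lam i powr (1 / B)) * (1 + (lam i)\<^sup>2 * \<mu>\<^sub>2) <
       \<eta>\<^sup>2 * exp (- (lam i powr (1 / \<beta>) * ln (1 + lam i))) * exp (\<kappa> * lam i powr (1 - \<alpha>) - L)"
    by auto
  define l where "l = lam i"
  define W where "W = exp (l powr (1 / \<beta>) * ln (1 + l))"
  have "0 < W" by (simp add: W_def)
  obtain c where c: "c \<in> coefficients \<mu>\<^sub>1 \<mu>\<^sub>2 H \<alpha>" "coefficients_dist c\<^sub>0 c \<le> \<eta>"
    and grow: "\<And>u u' t. solves_on {0..} (\<lambda>t. l\<^sup>2 * c t) u u' \<Longrightarrow> u 0 = 0 \<Longrightarrow> t \<in> {1 / k..k} \<Longrightarrow>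
       (u' 0)\<^sup>2 * exp (\<kappa> * l powr (1 - \<alpha>) - L) \<le> (1 + l\<^sup>2 * \<mu>\<^sub>2) * ((u t)\<^sup>2 + (u' t)\<^sup>2)"
    using res i(1) unfolding l_def by blast
  \<comment> \<open>The perturbation has norm exactly \<open>\<eta>\<close>; its sign rules out
    cancellation in \<open>\<psi>\<^sub>0 i - x\<close>, so the new component is at least
    \<open>\<eta> / sqrt W\<close> in modulus.\<close>
  define x where "x = (if 0 \<le> \<psi>\<^sub>0 i then - (\<eta> / sqrt W) else \<eta> / sqrt W)"
  define \<psi> where "\<psi> = (\<lambda>j. \<psi>\<^sub>0 j - (if j = i then x else 0))"
  have \<psi>G: "\<psi> \<in> gevrey_inf lam \<beta>"
    unfolding \<psi>_def by (intro gevrey_inf_diff \<psi>0 gevrey_inf_single)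
  have "\<eta> / sqrt W \<le> \<bar>\<psi> i\<bar>"
    using \<open>0 < \<eta>\<close> \<open>0 < W\<close> by (auto simp: \<psi>_def x_def)
  then have "(\<eta> / sqrt W)\<^sup>2 \<le> \<bar>\<psi> i\<bar>\<^sup>2"
    using \<open>0 < \<eta>\<close> \<open>0 < W\<close> by (intro power_mono) auto
  moreover have "(\<eta> / sqrt W)\<^sup>2 = \<eta>\<^sup>2 * exp (- (l powr (1 / \<beta>) * ln (1 + l)))"
    using \<open>0 < W\<close> by (simp only: power_divide real_sqrt_pow2 less_imp_le) (simp add: W_def exp_minus divide_inverse)
  ultimately have \<psi>i: "\<eta>\<^sup>2 * exp (- (l powr (1 / \<beta>) * ln (1 + l))) \<le> (\<psi> i)\<^sup>2"
    by simp
  have "(\<lambda>j. \<psi>\<^sub>0 j - \<psi> j) = (\<lambda>j. if j = i then x else 0)"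
    by (auto simp: \<psi>_def)
  then have "gevrey_inf_norm lam \<beta> (\<lambda>j. \<psi>\<^sub>0 j - \<psi> j) = \<bar>x\<bar> * sqrt W"
    using gevrey_inf_single(2)[of lam \<beta> i x] by (simp add: W_def l_def)
  also have "\<dots> = \<eta>"
    using \<open>0 < \<eta>\<close> \<open>0 < W\<close> by (simp add: x_def abs_divide)
  finally have "d (c\<^sub>0, \<psi>\<^sub>0) (c, \<psi>) \<le> \<eta> + \<eta>"
    using c \<open>0 < \<eta>\<close> by (simp add: d_def X_dist_def)
  then have "d (c\<^sub>0, \<psi>\<^sub>0) (c, \<psi>) < \<epsilon>"
    using \<open>0 < \<epsilon>\<close> by (simp add: \<eta>_def)
  moreover have "(c, \<psi>) \<in> X"
    using c \<psi>G by (simp add: X_def X_space_def)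
  ultimately have "(c, \<psi>) \<in> tame_set X lam B k"
    using ball pX by (auto simp: X.in_mball)
  then obtain u u' t where u: "very_weak_solution lam c (\<lambda>i. 0) \<psi> u u'" and t: "t \<in> {1 / k..k}"
    and bd: "(u t i)\<^sup>2 + (u' t i)\<^sup>2 \<le> k * exp (2 * k * l powr (1 / B))"
    unfolding tame_set_def l_def by blast
  have sol: "solves_on {0..} (\<lambda>t. l\<^sup>2 * c t) (\<lambda>t. u t i) (\<lambda>t. u' t i)" "u 0 i = 0" "u' 0 i = \<psi> i"
    using u unfolding very_weak_solution_iff[OF coefficients_continuous_on[OF c(1) \<alpha>(1)]] l_def
    by auto
  have "k * exp (2 * k * l powr (1 / B)) * (1 + l\<^sup>2 * \<mu>\<^sub>2) <
       \<eta>\<^sup>2 * exp (- (l powr (1 / \<beta>) * ln (1 + l))) * exp (\<kappa> * l powr (1 - \<alpha>) - L)"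
    using i(2) by (simp add: l_def)
  also have "\<dots> \<le> (\<psi> i)\<^sup>2 * exp (\<kappa> * l powr (1 - \<alpha>) - L)"
    by (intro mult_right_mono \<psi>i) auto
  also have "\<dots> \<le> (1 + l\<^sup>2 * \<mu>\<^sub>2) * ((u t i)\<^sup>2 + (u' t i)\<^sup>2)"
    using grow[OF sol(1,2) t] sol(3) by simp
  also have "\<dots> \<le> (1 + l\<^sup>2 * \<mu>\<^sub>2) * (k * exp (2 * k * l powr (1 / B)))"
    using \<mu> by (intro mult_left_mono bd) auto
  finally show False by (simp add: mult.commute)
qed

theorem theorem3p2:
  fixes \<alpha> \<beta> B \<mu>\<^sub>1 \<mu>\<^sub>2 H :: real
    and D :: "'a::{real_inner, complete_space} set" and A :: "'a \<Rightarrow> 'a"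
    and e :: "nat \<Rightarrow> 'a" and lam :: "nat \<Rightarrow> real"
  assumes "\<alpha> \<in> {0<..<1}" and "\<beta> > 1 / (1 - \<alpha>)" and "B > 1 / (1 - \<alpha>)"
    and "0 < \<mu>\<^sub>1" and "\<mu>\<^sub>1 < \<mu>\<^sub>2" and "H > 0"
    and "\<not> (\<exists>F::'a set. finite F \<and> span F = UNIV)"
    and "self_adjoint_operator D A" and "nonnegative_operator D A"
    and "diagonalized_by D A e lam"
  shows "residual_in
           (Metric_space.mtopology (X_space \<mu>\<^sub>1 \<mu>\<^sub>2 H \<alpha> lam \<beta>) (X_dist \<mu>\<^sub>1 \<mu>\<^sub>2 H \<alpha> lam \<beta>))
           {(c, \<psi>) \<in> X_space \<mu>\<^sub>1 \<mu>\<^sub>2 H \<alpha> lam \<beta>.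
              \<exists>u u'. very_weak_solution lam c (\<lambda>i. 0) \<psi> u u' \<and>
                (\<forall>t>0. \<forall>R>0. (u t, u' t)
                   \<notin> gevrey_ultradistributions lam B R \<times> gevrey_ultradistributions lam B R)}"
    (is "residual_in ?T ?S")
proof -
  let ?X = "X_space \<mu>\<^sub>1 \<mu>\<^sub>2 H \<alpha> lam \<beta>" and ?d = "X_dist \<mu>\<^sub>1 \<mu>\<^sub>2 H \<alpha> lam \<beta>"
  interpret X: Metric_space ?X ?d
    by (rule Metric_space_X)
  let ?C = "range (\<lambda>n. tame_set ?X lam B (real (Suc n)))"
  have lam: "filterlim lam at_top sequentially" and \<alpha>: "0 < \<alpha>" "\<alpha> < 1"
    using assms by (auto simp: diagonalized_by_def)
  have "closedin ?T C \<and> ?T interior_of C = {}" if C: "C \<in> ?C" for C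
  proof -
    obtain n where "C = tame_set ?X lam B (real (Suc n))"
      using C by blast
    then show ?thesis
      using closedin_tame_set[OF \<alpha>(1) assms(4)]
        interior_of_tame_set[OF \<alpha> assms(2,3,4,5,6) _ lam] by simp
  qed
  moreover have "topspace ?T - ?S \<subseteq> \<Union>?C"
  proof
    fix p assume "p \<in> topspace ?T - ?S"
    then obtain c \<psi> where p: "p = (c, \<psi>)" and pX: "(c, \<psi>) \<in> ?X" and pS: "(c, \<psi>) \<notin> ?S"
      by (cases p) auto
    from pX have "c \<in> coefficients \<mu>\<^sub>1 \<mu>\<^sub>2 H \<alpha>"
      by (simp add: X_space_def)
    \<comment> \<open>Outside \<open>?S\<close> every solution fails the requirement; witnesses
      \<open>t\<close> and \<open>R\<close> can be extracted only once a solution is known to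
      exist.\<close>
    then obtain u u' where u: "very_weak_solution lam c (\<lambda>i. 0) \<psi> u u'"
      using very_weak_solution_exists \<alpha>(1) assms(4) by blast
    with pX pS obtain t R where "0 < t" "0 < R"
      "u t \<in> gevrey_ultradistributions lam B R" "u' t \<in> gevrey_ultradistributions lam B R"
      by blast
    from tame_setI[OF pX u this] show "p \<in> \<Union>?C"
      unfolding p by blast
  qed
  ultimately show ?thesis
    unfolding residual_in_def by (intro conjI exI[of _ ?C]) auto
qed

end
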